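(* Let $N\ge1$, $h=N+1$, $\eta=e^{2\pi\sqrt{-1}/h}$, and let $\mathcal D(\hbar;\mathbf t)$ be the total descendant potential of the $A_N$-singularity. For $1\le a\le N$, $m\ge0$ let $$T_{m,a}=(-a+(m+1)h)\frac{\partial}{\partial x_{m,a}}+\operatorname{Res}_{\lambda=0}\frac1h\sum_{i=1}^h\sum_{\{j_1,\dots,j_r\}}\frac{\eta^{-ia}\lambda^{m+1-\frac1h(a+r)}}{\prod_{s=1}^r(\eta^i-\eta^{j_s})}\,\hbar^{(r-1)/2}X_{i,j_1,\dots,j_r}(\lambda)\,d\lambda$$ (second sum over all non-empty subsets $\{j_1,\dots,j_r\}\subset\{1,\dots,h\}\setminus\{i\}$) be the differential operators of the topological recursion, i.e. the recursion is the set of constraints $T_{m,a}\mathcal D(\hbar;\mathbf t)=0$, $1\le a\le N$, $m\ge0$. Then under the dilaton shift $$t_{k,i}=q_{k,i}+\delta_{k,1}\delta_{i,N},\qquad 1\le i\le N,\ k\ge0,$$ this set of differential constraints turns into the set of constraints $$\operatorname{Res}_{\lambda=0}\ \lambda^mX(e_{h+1-a},\lambda)\,d\lambda\ \,\mathcal D(\hbar;\mathbf q)=0,\qquad1\le a\le N,\ m\ge0;$$ that is, for each $(m,a)$ the operator $T_{m,a}$ becomes, up to multiplication by a non-zero constant and a power of $\hbar^{1/2}$, the operator $\operatorname{Res}_{\lambda=0}\lambda^mX(e_{h+1-a},\lambda)\,d\lambda$. Here $e_r$ is the degree-$r$ elementary symmetric polynomial in $\chi_1,\dots,\chi_h$,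 and $\mathcal D(\hbar;\mathbf q)$ denotes $\mathcal D(\hbar;\mathbf t)$ written in the variables $q_{k,i}$.
   Context: **Operators in $\mathbf t$.** $\mathbf{t}=\{t_{k,a}\}$, $1\le a\le N$, $k\ge0$, are formal variables, $x_{k,a}=\frac{t_{k,a}}{(-a+h)(-a+2h)\cdots(-a+kh)}$ (so $x_{0,a}=t_{0,a}$). For $1\le a\le N$ put $\Phi_a(\lambda)=\sum_{m\ge0}\big(\lambda^mx_{m,a}\hbar^{-1/2}+\lambda^{-m-1}(a+mh)\hbar^{1/2}\partial/\partial x_{m,h-a}\big)$; for $1\le j\le h$ put $X_j(\lambda)=\sum_{a=1}^N\eta^{-ja}\Phi_a(\lambda)\lambda^{-a/h}$; for $1\le i\ne j\le h$ put $P_{ij}(\lambda)=\frac{\eta^{i+j}}{(\eta^i-\eta^j)^2}\lambda^{-2}$. For $J=\{j_1,\dots,j_r\}\subset\{1,\dots,h\}$, $$X_{j_1,\dots,j_r}(\lambda)=\sum\Big(\prod_{s=1}^{r'}P_{i_s^{(1)},i_s^{(2)}}(\lambda)\Big)\ {:}\prod_{j\in J\setminus I}X_j(\lambda){:},$$ the sum being over all (possibly empty) collections of pairwise disjoint pairs $(i_s^{(1)},i_s^{(2)})$, $1\le s\le r'$, of elements of $J$ with $i_s^{(1)}<i_s^{(2)}$, $i_1^{(1)}<\dots<i_{r'}^{(1)}$, with $I=\bigcup_s\{i_s^{(1)},i_s^{(2)}\}$; ${:}\ {:}$ is the normal ordering in which differentiations are applied before multiplications. $\operatorname{Res}_{\lambda=0}f\,d\lambda$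 is the coefficient of $\lambda^{-1}$ in $f$. **Twisted fields in $\mathbf q$.** $\chi_1,\dots,\chi_h$ are the weights of type $A_N$: the coordinate functions of $\mathbb{C}^{h}$ restricted to the hyperplane $\chi_1+\dots+\chi_h=0$, with $(\chi_i|\chi_j)=\delta_{ij}-1/h$. The twisted field $X(\chi_{j_1}\cdots\chi_{j_r},\lambda)$ ($j_1<\dots<j_r$), from the state–field correspondence of the Heisenberg vertex algebra given by the periods of the $A_N$-singularity at $t=0$, is explicitly the following operator in the variables $q_{k,a}$: it is $X_{j_1,\dots,j_r}(h\lambda)$ with every $t_{k,a}$ replaced by $q_{k,a}$ (and $\partial/\partial t_{k,a}$ by $\partial/\partial q_{k,a}$). (The rescaling $\lambda\mapsto h\lambda$ only changes $\operatorname{Res}_{\lambda=0}\lambda^mX(\cdot,\lambda)d\lambda$ by a non-zero constant.) By linearity $X(e_r,\lambda)=\sum_{1\le j_1<\dots<j_r\le h}X(\chi_{j_1}\cdots\chi_{j_r},\lambda)$, $2\le r\le h$. **Frobenius structure.** Let $F(s,x)=\frac{x^{N+1}}{N+1}+s_1x^{N-1}+\dots+s_N$, $s\in B=\mathbb{C}^N$. Each $T_sB\cong\mathbb{C}[x]/(\partial_xF(s,x))$, $\partial/\partial s_i\mapsto\partial_{s_i}F$, is thereby an algebra with product $\bullet_s$, and carries the residue pairing $(\partial_{s_i},\partial_{s_j})=\frac{1}{2\pi\sqrt{-1}}\oint\frac{\partial_{s_i}F\,\partial_{s_j}F}{\partial_xF}dx$ (over a large loop enclosing all critical points). The pairing is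 flat; let $(t_1,\dots,t_N)$ be flat coordinates on $B$ vanishing at $s=0$ such that $\partial/\partial t_i$ at $s=0$ corresponds to $\phi_i=x^{N-i}\in H:=\mathbb{C}[x]/(x^N)$. Then $(\phi_a,\phi_b)=\delta_{a+b,N+1}$, and $TB\cong B\times H$ via $\partial/\partial t_i\leftrightarrow\phi_i$. This is a conformal, generically semisimple Frobenius manifold with unit $\phi_N$; put $d_i=(N-i)/(N+1)$, $D=(N-1)/(N+1)$. **Total descendant potential.** Let $\Lambda_{g,n}:H^{\otimes n}\to H^*(\overline{\mathcal M}_{g,n};\mathbb{C})$ ($2g-2+n>0$) be the unique (Givental–Teleman) cohomological field theory with flat unit $\phi_N$ and pairing $(\ ,\ )$ such that (i) $\Lambda_{g,n}(\phi_{a_1},\dots,\phi_{a_n})$ is of pure complex degree $D(g-1)+\sum_id_{a_i}$, and (ii) its genus-0 primary potential $F_0(t)=\sum_{n\ge3}\frac1{n!}\int_{\overline{\mathcal M}_{0,n}}\Lambda_{0,n}(\sum t_a\phi_a,\dots,\sum t_a\phi_a)$ satisfies $\partial_{t_a}\partial_{t_b}\partial_{t_c}F_0(t)=(\partial_{t_a}\bullet_t\partial_{t_b},\partial_{t_c})$. Then $\mathcal D(\hbar;\mathbf t)=\exp(\sum_{g\ge0}\hbar^{g-1}\mathcal F^{(g)}(\mathbf t))$ with $$\mathcal F^{(g)}(\mathbf t)=\sum_{n:\,2g-2+n>0}\frac1{n!}\sum_{\substack{k_1,\dots,k_n\geq 0\\ 1\leq a_1,\dots,a_n\leq N}}\Big(\int_{\overline{\mathcal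 M}_{g,n}}\Lambda_{g,n}(\phi_{a_1},\dots,\phi_{a_n})\psi_1^{k_1}\cdots\psi_n^{k_n}\Big)t_{k_1,a_1}\cdots t_{k_n,a_n}.$$ *)

theory Defs
  imports
    "HOL-Complex_Analysis.Complex_Analysis"
    "HOL-Combinatorics.Combinatorics"
    "HOL-Computational_Algebra.Computational_Algebra"
begin

section \<open>Formal functions of the variables t, and elementary operators\<close>

text \<open>
  A formal function is a formal power series in the variables \<open>t\<^sub>k\<^sub>,\<^sub>a\<close> whose coefficients are
  Laurent series in \<open>\<hbar>\<^sup>1\<^sup>/\<^sup>2\<close>; a monomial is a multiset of index pairs \<open>(k, a)\<close>, and the variable
  \<open>fls_X\<close> of the coefficient field stands for \<open>\<hbar>\<^sup>1\<^sup>/\<^sup>2\<close>.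
\<close>

type_synonym monomial = "(nat \<times> nat) multiset"
type_synonym formal_fun = "monomial \<Rightarrow> complex fls"
type_synonym operator = "formal_fun \<Rightarrow> formal_fun"

definition hbar_half_pow :: "int \<Rightarrow> complex fls" where
  "hbar_half_pow e = fls_X_intpow e"

definition fscale :: "complex fls \<Rightarrow> operator" where
  "fscale c f = (\<lambda>M. c * f M)"

definition t_var :: "nat \<Rightarrow> nat \<Rightarrow> operator" where
  "t_var k a f = (\<lambda>M. if (k, a) \<in># M then f (M - {#(k, a)#}) else 0)"

definition t_diff :: "nat \<Rightarrow> nat \<Rightarrow> operator" where
  "t_diff k a f = (\<lambda>M. of_nat (Suc (count M (k, a))) * f (add_mset (k, a) M))"

text \<open>
  The dilaton shift \<open>t\<^sub>k\<^sub>,\<^sub>i = q\<^sub>k\<^sub>,\<^sub>i + \<delta>\<^sub>k\<^sub>,\<^sub>1 \<delta>\<^sub>i\<^sub>,\<^sub>N\<close>: it is a change of coordinates, so a function of t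
  written in the variables q is the same formal function, now expanded about the point
  \<open>q\<^sub>k\<^sub>,\<^sub>i = - \<delta>\<^sub>k\<^sub>,\<^sub>1 \<delta>\<^sub>i\<^sub>,\<^sub>N\<close>.  On it \<open>q\<^sub>k\<^sub>,\<^sub>i\<close> acts as multiplication by \<open>t\<^sub>k\<^sub>,\<^sub>i - \<delta>\<^sub>k\<^sub>,\<^sub>1 \<delta>\<^sub>i\<^sub>,\<^sub>N\<close>, and the
  derivative with respect to \<open>q\<^sub>k\<^sub>,\<^sub>i\<close> is the derivative with respect to \<open>t\<^sub>k\<^sub>,\<^sub>i\<close>.
\<close>

definition q_var :: "nat \<Rightarrow> nat \<Rightarrow> nat \<Rightarrow> operator" where
  "q_var N k i f = (\<lambda>M. t_var k i f M - (if k = 1 \<and> i = N then f M else 0))"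

text \<open>
  Below, the parameter \<open>v\<close> is the family of multiplication operators by the variables in which an
  operator is written: \<open>t_var\<close> or \<open>q_var N\<close>.
\<close>

definition x_factor :: "nat \<Rightarrow> nat \<Rightarrow> nat \<Rightarrow> complex" where
  "x_factor N k a = (\<Prod>l=1..k. of_nat (l * (N + 1)) - of_nat a)"

definition x_mult :: "nat \<Rightarrow> (nat \<Rightarrow> nat \<Rightarrow> operator) \<Rightarrow> nat \<Rightarrow> nat \<Rightarrow> operator" where
  "x_mult N v k a f = fscale (fls_const (1 / x_factor N k a)) (v k a f)"

definition x_diff :: "nat \<Rightarrow> nat \<Rightarrow> nat \<Rightarrow> operator" where
  "x_diff N k a f = fscale (fls_const (x_factor N k a)) (t_diff k a f)"

section \<open>Operator-valued series in fractional powers of the spectral parameter\<close>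

text \<open>\<open>A p\<close> is the coefficient of \<open>\<lambda>\<^sup>p\<close>.\<close>

type_synonym op_series = "rat \<Rightarrow> operator"

definition lambda_times :: "rat \<Rightarrow> op_series \<Rightarrow> op_series" where
  "lambda_times e A = (\<lambda>p. A (p - e))"

definition Res0 :: "op_series \<Rightarrow> operator" where
  "Res0 A = A (-1)"

text \<open>The substitution \<open>\<lambda> \<mapsto> c \<lambda>\<close>, with the positive branch of the fractional powers of c.\<close>

definition rescale :: "real \<Rightarrow> op_series \<Rightarrow> op_series" where
  "rescale c A = (\<lambda>p f. fscale (fls_const (of_real (c powr of_rat p))) (A p f))"

definition eta :: "nat \<Rightarrow> complex" where
  "eta N = exp (2 * of_real pi * \<i> / of_nat (N + 1))"

text \<open>
  The field \<open>X\<^sub>j(\<lambda>) = \<Sum>\<^sub>a \<eta>\<^sup>-\<^sup>j\<^sup>a \<Phi>\<^sub>a(\<lambda>) \<lambda>\<^sup>-\<^sup>a\<^sup>/\<^sup>h\<close> is the sum over its modes of coefficient times power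
  of \<open>\<lambda>\<close> times elementary operator: \<open>Creation m a\<close> is the term of \<open>\<Phi>\<^sub>a(\<lambda>)\<close> with \<open>\<lambda>\<^sup>m x\<^sub>m\<^sub>,\<^sub>a\<close>, and
  \<open>Annihilation m a\<close> is the term with \<open>\<lambda>\<^sup>-\<^sup>m\<^sup>-\<^sup>1\<close> and the derivative with respect to \<open>x\<^sub>m\<^sub>,\<^sub>h\<^sub>-\<^sub>a\<close>.
\<close>

datatype mode = Creation nat nat | Annihilation nat nat

fun is_creation :: "mode \<Rightarrow> bool" where
  "is_creation (Creation m a) = True"
| "is_creation (Annihilation m a) = False"

definition modes :: "nat \<Rightarrow> mode set" where
  "modes N = {Creation m a | m a. a \<in> {1..N}} \<union> {Annihilation m a | m a. a \<in> {1..N}}"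

fun mode_exponent :: "nat \<Rightarrow> mode \<Rightarrow> rat" where
  "mode_exponent N (Creation m a) = of_nat m - of_nat a / of_nat (N + 1)"
| "mode_exponent N (Annihilation m a) = - of_nat m - 1 - of_nat a / of_nat (N + 1)"

fun mode_coeff :: "nat \<Rightarrow> nat \<Rightarrow> mode \<Rightarrow> complex fls" where
  "mode_coeff N j (Creation m a) =
     fls_const (eta N powi (- int (j * a))) * hbar_half_pow (-1)"
| "mode_coeff N j (Annihilation m a) =
     fls_const (eta N powi (- int (j * a)) * of_nat (a + m * (N + 1))) * hbar_half_pow 1"

fun mode_op :: "nat \<Rightarrow> (nat \<Rightarrow> nat \<Rightarrow> operator) \<Rightarrow> mode \<Rightarrow> operator" where
  "mode_op N v (Creation m a) = x_mult N v m a"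
| "mode_op N v (Annihilation m a) = x_diff N m (N + 1 - a)"

text \<open>\<open>foldr\<close> applies the last operator of the list first.\<close>

definition normal_ordered_modes ::
    "nat \<Rightarrow> (nat \<Rightarrow> nat \<Rightarrow> operator) \<Rightarrow> mode list \<Rightarrow> operator" where
  "normal_ordered_modes N v cs =
     foldr (mode_op N v) (filter is_creation cs @ filter (\<lambda>c. \<not> is_creation c) cs)"

text \<open>
  A sum of infinitely many operators, taken coefficientwise.  In every use below, each coefficient
  of the result receives only finitely many non-zero contributions.
\<close>

definition op_sum :: "'i set \<Rightarrow> ('i \<Rightarrow> operator) \<Rightarrow> operator" where
  "op_sum A F f = (\<lambda>M. \<Sum>i | i \<in> A \<and> F i f M \<noteq> 0. F i f M)"

text \<open>The normally ordered product of the \<open>X\<^sub>j(\<lambda>)\<close>, \<open>j \<in> S\<close>, multiplied out into modes.\<close>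

definition normal_product ::
    "nat \<Rightarrow> (nat \<Rightarrow> nat \<Rightarrow> operator) \<Rightarrow> nat set \<Rightarrow> op_series" where
  "normal_product N v S = (\<lambda>p.
     (let js = sorted_list_of_set S in
      op_sum {cs. length cs = length js \<and> set cs \<subseteq> modes N \<and> sum_list (map (mode_exponent N) cs) = p}
        (\<lambda>cs f. fscale (prod_list (map2 (mode_coeff N) js cs)) (normal_ordered_modes N v cs f))))"

definition P_coeff :: "nat \<Rightarrow> nat \<Rightarrow> nat \<Rightarrow> complex" where
  "P_coeff N i j = eta N ^ (i + j) / (eta N ^ i - eta N ^ j)\<^sup>2"

definition pairings :: "nat set \<Rightarrow> (nat \<times> nat) set set" where
  "pairings J = {\<pi>. \<pi> \<subseteq> {(i, j). i \<in> J \<and> j \<in> J \<and> i < j} \<and>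
     (\<forall>p\<in>\<pi>. \<forall>p'\<in>\<pi>. p \<noteq> p' \<longrightarrow> {fst p, snd p} \<inter> {fst p', snd p'} = {})}"

definition X_field :: "nat \<Rightarrow> (nat \<Rightarrow> nat \<Rightarrow> operator) \<Rightarrow> nat set \<Rightarrow> op_series" where
  "X_field N v J = (\<lambda>p f M. \<Sum>\<pi>\<in>pairings J.
     fscale (fls_const (\<Prod>(i, j)\<in>\<pi>. P_coeff N i j))
       (lambda_times (- 2 * of_nat (card \<pi>)) (normal_product N v (J - (fst ` \<pi> \<union> snd ` \<pi>))) p f) M)"

section \<open>The two families of operators\<close>

definition recursion_op ::
    "nat \<Rightarrow> (nat \<Rightarrow> nat \<Rightarrow> operator) \<Rightarrow> nat \<Rightarrow> nat \<Rightarrow> operator" where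
  "recursion_op N v m a f = (\<lambda>M.
     fscale (of_nat ((m + 1) * (N + 1)) - of_nat a) (x_diff N m a f) M +
     (\<Sum>i=1..N+1. \<Sum>J | J \<subseteq> {1..N+1} - {i} \<and> J \<noteq> {}.
        fscale
          (fls_const (1 / of_nat (N + 1) * (eta N powi (- int (i * a)) / (\<Prod>j\<in>J. eta N ^ i - eta N ^ j)))
            * hbar_half_pow (int (card J) - 1))
          (Res0 (lambda_times (of_nat m + 1 - of_nat (a + card J) / of_nat (N + 1))
             (X_field N v (insert i J))) f) M))"

text \<open>
  The twisted field of the monomial \<open>\<Prod>\<^sub>j\<^sub>\<in>\<^sub>J \<chi>\<^sub>j\<close> in the weights, and that of the elementary symmetric
  polynomial \<open>e\<^sub>r(\<chi>\<^sub>1, \<dots>, \<chi>\<^sub>h)\<close>, obtained by linearity of the state-field correspondence.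
\<close>

definition twisted_field ::
    "nat \<Rightarrow> (nat \<Rightarrow> nat \<Rightarrow> operator) \<Rightarrow> nat set \<Rightarrow> op_series" where
  "twisted_field N v J = rescale (of_nat (N + 1)) (X_field N v J)"

definition twisted_field_elem_sym ::
    "nat \<Rightarrow> (nat \<Rightarrow> nat \<Rightarrow> operator) \<Rightarrow> nat \<Rightarrow> op_series" where
  "twisted_field_elem_sym N v r =
     (\<lambda>p f M. \<Sum>J | J \<subseteq> {1..N+1} \<and> card J = r. twisted_field N v J p f M)"

definition W_op :: "nat \<Rightarrow> (nat \<Rightarrow> nat \<Rightarrow> operator) \<Rightarrow> nat \<Rightarrow> nat \<Rightarrow> operator" where
  "W_op N v m a = Res0 (lambda_times (of_nat m) (twisted_field_elem_sym N v (N + 2 - a)))"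

section \<open>The Frobenius structure of the singularity\<close>

text \<open>
  A point \<open>s\<close> of \<open>\<complex>\<^sup>N\<close> is a function supported on \<open>{1..N}\<close>.  A tangent vector of the base at \<open>s\<close> is
  identified with a polynomial in x of degree less than N via \<open>\<partial>/\<partial>s\<^sub>i \<mapsto> \<partial>F/\<partial>s\<^sub>i = x\<^sup>N\<^sup>-\<^sup>i\<close>.
\<close>

definition cspace :: "nat \<Rightarrow> (nat \<Rightarrow> complex) set" where
  "cspace N = {s. \<forall>i. i \<notin> {1..N} \<longrightarrow> s i = 0}"

definition miniversal :: "nat \<Rightarrow> (nat \<Rightarrow> complex) \<Rightarrow> complex poly" where
  "miniversal N s = monom (1 / of_nat (N + 1)) (N + 1) + (\<Sum>i=1..N. monom (s i) (N - i))"

definition jacobi_mult :: "nat \<Rightarrow> (nat \<Rightarrow> complex) \<Rightarrow> complex poly \<Rightarrow> complex poly \<Rightarrow> complex poly" where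
  "jacobi_mult N s f g = (f * g) mod pderiv (miniversal N s)"

text \<open>
  The contour integral does not depend on the radius R once the circle encloses all the critical
  points, so that the limit is its value over a large loop.
\<close>

definition residue_pairing :: "nat \<Rightarrow> (nat \<Rightarrow> complex) \<Rightarrow> complex poly \<Rightarrow> complex poly \<Rightarrow> complex" where
  "residue_pairing N s f g = Lim at_top (\<lambda>R::real.
     1 / (2 * of_real pi * \<i>) * contour_integral (circlepath 0 R)
       (\<lambda>x. poly f x * poly g x / poly (pderiv (miniversal N s)) x))"

definition partial :: "nat \<Rightarrow> ((nat \<Rightarrow> complex) \<Rightarrow> complex) \<Rightarrow> (nat \<Rightarrow> complex) \<Rightarrow> complex" where
  "partial i f t = deriv (\<lambda>z. f (t(i := z))) (t i)"

text \<open>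
  \<open>\<sigma>\<close> expresses the point \<open>s\<close> through its coordinates \<open>t\<close>; \<open>coord_field N \<sigma> t a\<close> is the coordinate
  vector field \<open>\<partial>/\<partial>t\<^sub>a\<close> at the point \<open>\<sigma> t\<close>.
\<close>

definition coord_field ::
    "nat \<Rightarrow> ((nat \<Rightarrow> complex) \<Rightarrow> (nat \<Rightarrow> complex)) \<Rightarrow> (nat \<Rightarrow> complex) \<Rightarrow> nat \<Rightarrow> complex poly" where
  "coord_field N \<sigma> t a = (\<Sum>j=1..N. monom (partial a (\<lambda>u. \<sigma> u j) t) (N - j))"

text \<open>
  Holomorphy in several variables is stated as separate holomorphy (equivalent, by Hartogs); the
  inverse of an injective holomorphic map between open subsets of \<open>\<complex>\<^sup>N\<close> is holomorphic.
\<close>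

definition flat_coordinates :: "nat \<Rightarrow> ((nat \<Rightarrow> complex) \<Rightarrow> (nat \<Rightarrow> complex)) \<Rightarrow> bool" where
  "flat_coordinates N \<sigma> \<longleftrightarrow>
     bij_betw \<sigma> (cspace N) (cspace N) \<and>
     (\<forall>t\<in>cspace N. \<forall>i\<in>{1..N}. \<forall>j\<in>{1..N}. (\<lambda>z. \<sigma> (t(i := z)) j) holomorphic_on UNIV) \<and>
     \<sigma> (\<lambda>_. 0) = (\<lambda>_. 0) \<and>
     (\<forall>a\<in>{1..N}. coord_field N \<sigma> (\<lambda>_. 0) a = monom 1 (N - a)) \<and>
     (\<forall>t\<in>cspace N. \<forall>a\<in>{1..N}. \<forall>b\<in>{1..N}.
        residue_pairing N (\<sigma> t) (coord_field N \<sigma> t a) (coord_field N \<sigma> t b) =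
        residue_pairing N (\<lambda>_. 0) (coord_field N \<sigma> (\<lambda>_. 0) a) (coord_field N \<sigma> (\<lambda>_. 0) b))"

section \<open>Cohomology of the moduli spaces of stable curves\<close>

text \<open>
  The moduli spaces \<open>M\<^sub>g\<^sub>,\<^sub>n\<close> (here always compactified) are not available in the libraries.  They enter
  through their cohomology, given as a structure which carries the operations used in the
  definition of a cohomological field theory and of its descendant correlators, and is required to
  satisfy the standard properties of these operations.

  The marked points of a curve in \<open>M\<^sub>g\<^sub>,\<^sub>n\<close> are numbered \<open>0, \<dots>, n - 1\<close>.

  \<^item> \<open>coh g n d\<close> is \<open>H\<^sup>d(M\<^sub>g\<^sub>,\<^sub>n; \<complex>)\<close>, \<open>cup g n\<close> and \<open>unit_class g n\<close> its product and unit;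
  \<^item> \<open>coh_prod g\<^sub>1 n\<^sub>1 g\<^sub>2 n\<^sub>2 d\<close> is \<open>H\<^sup>d\<close> of \<open>M\<^sub>g\<^sub>1\<^sub>,\<^sub>n\<^sub>1 \<times> M\<^sub>g\<^sub>2\<^sub>,\<^sub>n\<^sub>2\<close>, and \<open>cross\<close> is the exterior product;
  \<^item> \<open>relabel g n \<pi>\<close> is the pullback by \<open>(C; p\<^sub>i) \<mapsto> (C; p\<^sub>\<pi>\<^sub>(\<^sub>i\<^sub>))\<close>;
  \<^item> \<open>forget g n\<close> is the pullback by the map \<open>M\<^sub>g\<^sub>,\<^sub>n\<^sub>+\<^sub>1 \<rightarrow> M\<^sub>g\<^sub>,\<^sub>n\<close> forgetting the last point;
  \<^item> \<open>glue_loop g n\<close> is the pullback by \<open>M\<^sub>g\<^sub>,\<^sub>n\<^sub>+\<^sub>2 \<rightarrow> M\<^sub>g\<^sub>+\<^sub>1\<^sub>,\<^sub>n\<close>, which glues the last two points;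
  \<^item> \<open>glue_tree g\<^sub>1 n\<^sub>1 g\<^sub>2 n\<^sub>2\<close> is the pullback by \<open>M\<^sub>g\<^sub>1\<^sub>,\<^sub>n\<^sub>1\<^sub>+\<^sub>1 \<times> M\<^sub>g\<^sub>2\<^sub>,\<^sub>n\<^sub>2\<^sub>+\<^sub>1 \<rightarrow> M\<^sub>g\<^sub>1\<^sub>+\<^sub>g\<^sub>2\<^sub>,\<^sub>n\<^sub>1\<^sub>+\<^sub>n\<^sub>2\<close>, which
    glues the last points of the two curves;
  \<^item> \<open>psi g n i\<close> is the first Chern class of the cotangent line at the i-th point;
  \<^item> \<open>fund_int g n\<close> is the integral over \<open>M\<^sub>g\<^sub>,\<^sub>n\<close>.
\<close>

record 'c moduli_cohomology =
  scal :: "complex \<Rightarrow> 'c \<Rightarrow> 'c"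
  coh :: "nat \<Rightarrow> nat \<Rightarrow> nat \<Rightarrow> 'c set"
  cup :: "nat \<Rightarrow> nat \<Rightarrow> 'c \<Rightarrow> 'c \<Rightarrow> 'c"
  unit_class :: "nat \<Rightarrow> nat \<Rightarrow> 'c"
  coh_prod :: "nat \<Rightarrow> nat \<Rightarrow> nat \<Rightarrow> nat \<Rightarrow> nat \<Rightarrow> 'c set"
  cross :: "nat \<Rightarrow> nat \<Rightarrow> nat \<Rightarrow> nat \<Rightarrow> 'c \<Rightarrow> 'c \<Rightarrow> 'c"
  relabel :: "nat \<Rightarrow> nat \<Rightarrow> (nat \<Rightarrow> nat) \<Rightarrow> 'c \<Rightarrow> 'c"
  forget :: "nat \<Rightarrow> nat \<Rightarrow> 'c \<Rightarrow> 'c"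
  glue_loop :: "nat \<Rightarrow> nat \<Rightarrow> 'c \<Rightarrow> 'c"
  glue_tree :: "nat \<Rightarrow> nat \<Rightarrow> nat \<Rightarrow> nat \<Rightarrow> 'c \<Rightarrow> 'c"
  psi :: "nat \<Rightarrow> nat \<Rightarrow> nat \<Rightarrow> 'c"
  fund_int :: "nat \<Rightarrow> nat \<Rightarrow> 'c \<Rightarrow> complex"

definition stable :: "nat \<Rightarrow> nat \<Rightarrow> bool" where
  "stable g n \<longleftrightarrow> 2 * g + n > 2"

definition total_coh :: "'c::ab_group_add moduli_cohomology \<Rightarrow> nat \<Rightarrow> nat \<Rightarrow> 'c set" where
  "total_coh R g n = module.span (scal R) (\<Union>d. coh R g n d)"

definition linear_map_on ::
    "(complex \<Rightarrow> 'c \<Rightarrow> 'c) \<Rightarrow> (complex \<Rightarrow> 'd \<Rightarrow> 'd) \<Rightarrow> 'c set \<Rightarrow> ('c::ab_group_add \<Rightarrow> 'd::ab_group_add) \<Rightarrow> bool"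
  where
  "linear_map_on sc sc' V f \<longleftrightarrow>
     (\<forall>x\<in>V. \<forall>y\<in>V. f (x + y) = f x + f y) \<and> (\<forall>c. \<forall>x\<in>V. f (sc c x) = sc' c (f x))"

definition ring_pullback ::
    "'c::ab_group_add moduli_cohomology \<Rightarrow> nat \<Rightarrow> nat \<Rightarrow> nat \<Rightarrow> nat \<Rightarrow> ('c \<Rightarrow> 'c) \<Rightarrow> bool" where
  "ring_pullback R g n g' n' f \<longleftrightarrow>
     linear_map_on (scal R) (scal R) (total_coh R g n) f \<and>
     (\<forall>d. f ` coh R g n d \<subseteq> coh R g' n' d) \<and>
     f (unit_class R g n) = unit_class R g' n' \<and>
     (\<forall>x\<in>total_coh R g n. \<forall>y\<in>total_coh R g n. f (cup R g n x y) = cup R g' n' (f x) (f y))"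

definition direct_grading ::
    "(complex \<Rightarrow> 'c \<Rightarrow> 'c) \<Rightarrow> (nat \<Rightarrow> 'c::ab_group_add set) \<Rightarrow> bool" where
  "direct_grading sc V \<longleftrightarrow> (\<forall>d. module.subspace sc (V d)) \<and>
     (\<forall>m x. (\<forall>d\<le>m. x d \<in> V d) \<and> (\<Sum>d\<le>m. x d) = 0 \<longrightarrow> (\<forall>d\<le>m. x d = 0))"

locale stable_curve_cohomology =
  fixes R :: "'c::ab_group_add moduli_cohomology"
  assumes scal_vector_space: "vector_space (scal R)"
    and coh_grading: "stable g n \<Longrightarrow> direct_grading (scal R) (coh R g n)"
    and coh_above_top: "stable g n \<Longrightarrow> d > 2 * (3 * g + n - 3) \<Longrightarrow> coh R g n d = {0}"
    and cup_linear_left: "stable g n \<Longrightarrow> y \<in> total_coh R g n \<Longrightarrow>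
      linear_map_on (scal R) (scal R) (total_coh R g n) (\<lambda>x. cup R g n x y)"
    and cup_linear_right: "stable g n \<Longrightarrow> x \<in> total_coh R g n \<Longrightarrow>
      linear_map_on (scal R) (scal R) (total_coh R g n) (cup R g n x)"
    and cup_degree: "stable g n \<Longrightarrow> x \<in> coh R g n d \<Longrightarrow> y \<in> coh R g n e \<Longrightarrow>
      cup R g n x y \<in> coh R g n (d + e)"
    and cup_assoc: "stable g n \<Longrightarrow> x \<in> total_coh R g n \<Longrightarrow> y \<in> total_coh R g n \<Longrightarrow>
      z \<in> total_coh R g n \<Longrightarrow> cup R g n (cup R g n x y) z = cup R g n x (cup R g n y z)"
    and cup_graded_commute: "stable g n \<Longrightarrow> x \<in> coh R g n d \<Longrightarrow> y \<in> coh R g n e \<Longrightarrow>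
      cup R g n x y = scal R ((-1) ^ (d * e)) (cup R g n y x)"
    and unit_degree: "stable g n \<Longrightarrow> unit_class R g n \<in> coh R g n 0"
    and cup_unit: "stable g n \<Longrightarrow> x \<in> total_coh R g n \<Longrightarrow> cup R g n (unit_class R g n) x = x"
    and coh_prod_grading: "stable g1 n1 \<Longrightarrow> stable g2 n2 \<Longrightarrow>
      direct_grading (scal R) (coh_prod R g1 n1 g2 n2)"
    and cross_linear_left: "stable g1 n1 \<Longrightarrow> stable g2 n2 \<Longrightarrow> y \<in> total_coh R g2 n2 \<Longrightarrow>
      linear_map_on (scal R) (scal R) (total_coh R g1 n1) (\<lambda>x. cross R g1 n1 g2 n2 x y)"
    and cross_linear_right: "stable g1 n1 \<Longrightarrow> stable g2 n2 \<Longrightarrow> x \<in> total_coh R g1 n1 \<Longrightarrow>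
      linear_map_on (scal R) (scal R) (total_coh R g2 n2) (cross R g1 n1 g2 n2 x)"
    and kunneth_span: "stable g1 n1 \<Longrightarrow> stable g2 n2 \<Longrightarrow>
      coh_prod R g1 n1 g2 n2 d = module.span (scal R)
        {cross R g1 n1 g2 n2 x y | x y e. e \<le> d \<and> x \<in> coh R g1 n1 e \<and> y \<in> coh R g2 n2 (d - e)}"
    and kunneth_inj: "stable g1 n1 \<Longrightarrow> stable g2 n2 \<Longrightarrow> finite B \<Longrightarrow> B \<subseteq> total_coh R g1 n1 \<Longrightarrow>
      \<not> module.dependent (scal R) B \<Longrightarrow> (\<And>b. b \<in> B \<Longrightarrow> w b \<in> total_coh R g2 n2) \<Longrightarrow>
      (\<Sum>b\<in>B. cross R g1 n1 g2 n2 b (w b)) = 0 \<Longrightarrow> b \<in> B \<Longrightarrow> w b = 0"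
    and relabel_pullback: "stable g n \<Longrightarrow> \<pi> permutes {..<n} \<Longrightarrow>
      ring_pullback R g n g n (relabel R g n \<pi>)"
    and relabel_id: "stable g n \<Longrightarrow> x \<in> total_coh R g n \<Longrightarrow> relabel R g n id x = x"
    and relabel_comp: "stable g n \<Longrightarrow> \<pi> permutes {..<n} \<Longrightarrow> \<rho> permutes {..<n} \<Longrightarrow>
      x \<in> total_coh R g n \<Longrightarrow> relabel R g n (\<pi> \<circ> \<rho>) x = relabel R g n \<pi> (relabel R g n \<rho> x)"
    and forget_pullback: "stable g n \<Longrightarrow> ring_pullback R g n g (Suc n) (forget R g n)"
    and glue_loop_pullback: "stable g (n + 2) \<Longrightarrow>
      ring_pullback R (Suc g) n g (n + 2) (glue_loop R g n)"
    and glue_tree_linear: "stable g1 (Suc n1) \<Longrightarrow> stable g2 (Suc n2) \<Longrightarrow>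
      linear_map_on (scal R) (scal R) (total_coh R (g1 + g2) (n1 + n2)) (glue_tree R g1 n1 g2 n2)"
    and glue_tree_degree: "stable g1 (Suc n1) \<Longrightarrow> stable g2 (Suc n2) \<Longrightarrow>
      glue_tree R g1 n1 g2 n2 ` coh R (g1 + g2) (n1 + n2) d \<subseteq> coh_prod R g1 (Suc n1) g2 (Suc n2) d"
    and glue_tree_unit: "stable g1 (Suc n1) \<Longrightarrow> stable g2 (Suc n2) \<Longrightarrow>
      glue_tree R g1 n1 g2 n2 (unit_class R (g1 + g2) (n1 + n2)) =
      cross R g1 (Suc n1) g2 (Suc n2) (unit_class R g1 (Suc n1)) (unit_class R g2 (Suc n2))"
    and psi_degree: "stable g n \<Longrightarrow> i < n \<Longrightarrow> psi R g n i \<in> coh R g n 2"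
    and psi_relabel: "stable g n \<Longrightarrow> \<pi> permutes {..<n} \<Longrightarrow> i < n \<Longrightarrow>
      relabel R g n \<pi> (psi R g n i) = psi R g n (\<pi> i)"
    and psi_glue_loop: "stable g (n + 2) \<Longrightarrow> i < n \<Longrightarrow>
      glue_loop R g n (psi R (Suc g) n i) = psi R g (n + 2) i"
    and psi_glue_tree_left: "stable g1 (Suc n1) \<Longrightarrow> stable g2 (Suc n2) \<Longrightarrow> i < n1 \<Longrightarrow>
      glue_tree R g1 n1 g2 n2 (psi R (g1 + g2) (n1 + n2) i) =
      cross R g1 (Suc n1) g2 (Suc n2) (psi R g1 (Suc n1) i) (unit_class R g2 (Suc n2))"
    and psi_glue_tree_right: "stable g1 (Suc n1) \<Longrightarrow> stable g2 (Suc n2) \<Longrightarrow> i < n2 \<Longrightarrow>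
      glue_tree R g1 n1 g2 n2 (psi R (g1 + g2) (n1 + n2) (n1 + i)) =
      cross R g1 (Suc n1) g2 (Suc n2) (unit_class R g1 (Suc n1)) (psi R g2 (Suc n2) i)"
    and int_linear: "stable g n \<Longrightarrow> linear_map_on (scal R) (*) (total_coh R g n) (fund_int R g n)"
    and int_degree: "stable g n \<Longrightarrow> x \<in> coh R g n d \<Longrightarrow> d \<noteq> 2 * (3 * g + n - 3) \<Longrightarrow>
      fund_int R g n x = 0"
    and int_relabel: "stable g n \<Longrightarrow> \<pi> permutes {..<n} \<Longrightarrow> x \<in> total_coh R g n \<Longrightarrow>
      fund_int R g n (relabel R g n \<pi> x) = fund_int R g n x"
    and poincare_duality: "stable g n \<Longrightarrow> x \<in> total_coh R g n \<Longrightarrow>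
      (\<And>y. y \<in> total_coh R g n \<Longrightarrow> fund_int R g n (cup R g n x y) = 0) \<Longrightarrow> x = 0"
    and coh_0_3: "coh R 0 3 0 = range (\<lambda>c. scal R c (unit_class R 0 3))"
    and int_0_3: "fund_int R 0 3 (unit_class R 0 3) = 1"

section \<open>The cohomological field theory and its total descendant potential\<close>

text \<open>
  A linear map \<open>\<Lambda>\<^sub>g\<^sub>,\<^sub>n\<close> on the n-th tensor power of H is given by its values on the basis:
  \<open>\<Lambda> g [a\<^sub>1, \<dots>, a\<^sub>n]\<close> is its value on \<open>\<phi>\<^sub>a\<^sub>1 \<otimes> \<dots> \<otimes> \<phi>\<^sub>a\<^sub>n\<close>.  As the pairing of \<open>\<phi>\<^sub>a\<close> and \<open>\<phi>\<^sub>b\<close> is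
  \<open>\<delta>\<^sub>a\<^sub>+\<^sub>b\<^sub>,\<^sub>N\<^sub>+\<^sub>1\<close>, the basis dual to \<open>\<phi>\<^sub>\<mu>\<close> is \<open>\<phi>\<^sub>N\<^sub>+\<^sub>1\<^sub>-\<^sub>\<mu>\<close>.
\<close>

definition cohft_flat_unit ::
    "'c::ab_group_add moduli_cohomology \<Rightarrow> nat \<Rightarrow> (nat \<Rightarrow> nat list \<Rightarrow> 'c) \<Rightarrow> bool" where
  "cohft_flat_unit R N \<Lambda> \<longleftrightarrow>
     (\<forall>g as. set as \<subseteq> {1..N} \<and> stable g (length as) \<longrightarrow> \<Lambda> g as \<in> total_coh R g (length as)) \<and>
     (\<forall>g as \<pi>. set as \<subseteq> {1..N} \<and> stable g (length as) \<and> \<pi> permutes {..<length as} \<longrightarrow>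
        \<Lambda> g as = relabel R g (length as) \<pi> (\<Lambda> g (permute_list \<pi> as))) \<and>
     (\<forall>g as. set as \<subseteq> {1..N} \<and> stable g (length as + 2) \<longrightarrow>
        glue_loop R g (length as) (\<Lambda> (Suc g) as) = (\<Sum>\<mu>=1..N. \<Lambda> g (as @ [\<mu>, N + 1 - \<mu>]))) \<and>
     (\<forall>g1 g2 as bs. set as \<subseteq> {1..N} \<and> set bs \<subseteq> {1..N} \<and>
        stable g1 (Suc (length as)) \<and> stable g2 (Suc (length bs)) \<longrightarrow>
        glue_tree R g1 (length as) g2 (length bs) (\<Lambda> (g1 + g2) (as @ bs)) =
        (\<Sum>\<mu>=1..N. cross R g1 (Suc (length as)) g2 (Suc (length bs))
                      (\<Lambda> g1 (as @ [\<mu>])) (\<Lambda> g2 (bs @ [N + 1 - \<mu>])))) \<and>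
     (\<forall>a\<in>{1..N}. \<forall>b\<in>{1..N}.
        \<Lambda> 0 [a, b, N] = scal R (if a + b = N + 1 then 1 else 0) (unit_class R 0 3)) \<and>
     (\<forall>g as. set as \<subseteq> {1..N} \<and> stable g (length as) \<longrightarrow>
        \<Lambda> g (as @ [N]) = forget R g (length as) (\<Lambda> g as))"

text \<open>
  Complex degree k is cohomological degree 2k; the class vanishes if the prescribed degree
  \<open>D (g - 1) + \<Sum> d\<^sub>a\<^sub>i\<close> is not a natural number.
\<close>

definition cohft_homogeneous ::
    "'c::ab_group_add moduli_cohomology \<Rightarrow> nat \<Rightarrow> (nat \<Rightarrow> nat list \<Rightarrow> 'c) \<Rightarrow> bool" where
  "cohft_homogeneous R N \<Lambda> \<longleftrightarrow>
     (\<forall>g as. set as \<subseteq> {1..N} \<and> stable g (length as) \<longrightarrow>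
        \<Lambda> g as = 0 \<or>
        (\<exists>k. (of_nat k :: rat) = (of_nat N - 1) / of_nat (N + 1) * (of_nat g - 1)
                + (\<Sum>a\<leftarrow>as. (of_nat N - of_nat a) / of_nat (N + 1)) \<and>
             \<Lambda> g as \<in> coh R g (length as) (2 * k)))"

definition primary_potential ::
    "'c moduli_cohomology \<Rightarrow> nat \<Rightarrow> (nat \<Rightarrow> nat list \<Rightarrow> 'c) \<Rightarrow> (nat \<Rightarrow> complex) \<Rightarrow> complex" where
  "primary_potential R N \<Lambda> t =
     (\<Sum>n. if n < 3 then 0 else
        1 / fact n * (\<Sum>as | length as = n \<and> set as \<subseteq> {1..N}.
           prod_list (map t as) * fund_int R 0 n (\<Lambda> 0 as)))"

definition primary_potential_matches ::
    "'c moduli_cohomology \<Rightarrow> nat \<Rightarrow> ((nat \<Rightarrow> complex) \<Rightarrow> (nat \<Rightarrow> complex)) \<Rightarrow>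
     (nat \<Rightarrow> nat list \<Rightarrow> 'c) \<Rightarrow> bool" where
  "primary_potential_matches R N \<sigma> \<Lambda> \<longleftrightarrow>
     (\<forall>t\<in>cspace N. \<forall>a\<in>{1..N}. \<forall>b\<in>{1..N}. \<forall>c\<in>{1..N}.
        partial a (partial b (partial c (primary_potential R N \<Lambda>))) t =
        residue_pairing N (\<sigma> t)
          (jacobi_mult N (\<sigma> t) (coord_field N \<sigma> t a) (coord_field N \<sigma> t b)) (coord_field N \<sigma> t c))"

definition A_singularity_cohft ::
    "'c::ab_group_add moduli_cohomology \<Rightarrow> nat \<Rightarrow> ((nat \<Rightarrow> complex) \<Rightarrow> (nat \<Rightarrow> complex)) \<Rightarrow>
     (nat \<Rightarrow> nat list \<Rightarrow> 'c) \<Rightarrow> bool" where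
  "A_singularity_cohft R N \<sigma> \<Lambda> \<longleftrightarrow>
     cohft_flat_unit R N \<Lambda> \<and> cohft_homogeneous R N \<Lambda> \<and> primary_potential_matches R N \<sigma> \<Lambda>"

definition psi_product :: "'c moduli_cohomology \<Rightarrow> nat \<Rightarrow> nat list \<Rightarrow> 'c" where
  "psi_product R g ks =
     foldr (\<lambda>i. (cup R g (length ks) (psi R g (length ks) i)) ^^ (ks ! i)) [0..<length ks]
       (unit_class R g (length ks))"

definition correlator ::
    "'c moduli_cohomology \<Rightarrow> (nat \<Rightarrow> nat list \<Rightarrow> 'c) \<Rightarrow> nat \<Rightarrow> (nat \<times> nat) list \<Rightarrow> complex" where
  "correlator R \<Lambda> g l =
     fund_int R g (length l)
       (cup R g (length l) (\<Lambda> g (map snd l)) (psi_product R g (map fst l)))"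

text \<open>The coefficient in \<open>\<F>\<^sup>(\<^sup>g\<^sup>)\<close> of a monomial in t.\<close>

definition genus_potential ::
    "'c moduli_cohomology \<Rightarrow> nat \<Rightarrow> (nat \<Rightarrow> nat list \<Rightarrow> 'c) \<Rightarrow> nat \<Rightarrow> monomial \<Rightarrow> complex" where
  "genus_potential R N \<Lambda> g M =
     (if stable g (size M) \<and> snd ` set_mset M \<subseteq> {1..N}
      then 1 / fact (size M) * (\<Sum>l | mset l = M. correlator R \<Lambda> g l) else 0)"

text \<open>
  \<open>\<Sum>\<^sub>g \<hbar>\<^sup>g\<^sup>-\<^sup>1 \<F>\<^sup>(\<^sup>g\<^sup>)\<close>: the power \<open>\<hbar>\<^sup>e\<^sup>/\<^sup>2\<close> occurs only for \<open>e = 2 (g - 1)\<close>.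
\<close>

definition free_energy ::
    "'c moduli_cohomology \<Rightarrow> nat \<Rightarrow> (nat \<Rightarrow> nat list \<Rightarrow> 'c) \<Rightarrow> formal_fun" where
  "free_energy R N \<Lambda> M =
     Abs_fls (\<lambda>e. if even e \<and> e \<ge> -2 then genus_potential R N \<Lambda> (nat (e div 2 + 1)) M else 0)"

definition ffun_one :: formal_fun where
  "ffun_one M = (if M = {#} then 1 else 0)"

definition ffun_mult :: "formal_fun \<Rightarrow> formal_fun \<Rightarrow> formal_fun" where
  "ffun_mult f g = (\<lambda>M. \<Sum>A | A \<subseteq># M. f A * g (M - A))"

text \<open>
  The exponential series, summed separately for each coefficient; for the free energy all these
  sums are finite, because its constant term has positive order in \<open>\<hbar>\<close>.
\<close>

definition ffun_exp :: "formal_fun \<Rightarrow> formal_fun" where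
  "ffun_exp f M = Abs_fls (\<lambda>e. \<Sum>k. fls_nth ((ffun_mult f ^^ k) ffun_one M) e / fact k)"

definition total_descendant_potential ::
    "'c moduli_cohomology \<Rightarrow> nat \<Rightarrow> (nat \<Rightarrow> nat list \<Rightarrow> 'c) \<Rightarrow> formal_fun" where
  "total_descendant_potential R N \<Lambda> = ffun_exp (free_energy R N \<Lambda>)"

end

theory Submission
  imports Defs
begin

text \<open>
  Since \<open>x\<^sub>1\<^sub>,\<^sub>N = t\<^sub>1\<^sub>,\<^sub>N\<close>, the dilaton shift subtracts the scalar
  \<open>\<eta>\<^sup>j \<lambda>\<^sup>1\<^sup>/\<^sup>h \<hbar>\<^sup>-\<^sup>1\<^sup>/\<^sup>2\<close> from every \<open>X\<^sub>j(\<lambda>)\<close>.  Both operators are therefore combinations of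
  the fields \<open>X\<^sub>K(\<lambda>)\<close> in the variables t, and it remains to compare coefficients.  With
  \<open>h = N + 1\<close>, \<open>r = h + 1 - a\<close> and \<open>k = |K|\<close>, the coefficient of \<open>X\<^sub>K\<close> in the twisted field of \<open>e\<^sub>r\<close>
  involves the elementary symmetric polynomial of degree \<open>r - k\<close> in the \<open>-\<eta>\<^sup>l\<close>, \<open>l \<notin> K\<close>, that
  in the recursion \<open>\<Sum>\<^sub>i\<^sub>\<in>\<^sub>K \<eta>\<^sup>-\<^sup>i\<^sup>a / \<Prod>\<^sub>j\<^sub>\<in>\<^sub>K\<^sub>-\<^sub>i (\<eta>\<^sup>i - \<eta>\<^sup>j)\<close>, and these two agree.  For \<open>k = 1\<close> the
  residue leaves exactly the derivative in the first term of the recursion, and \<open>k = 0\<close> contributes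
  only a positive power of \<open>\<lambda>\<close>, which has no residue.
\<close>

section \<open>Sums over roots of unity\<close>

lemma eta_power_order: "eta N ^ (N + 1) = 1"
proof -
  have "eta N ^ (N + 1) = exp (of_nat (N + 1) * (2 * of_real pi * \<i> / of_nat (N + 1)))"
    unfolding eta_def by (simp only: exp_of_nat_mult)
  also have "of_nat (N + 1) * (2 * of_real pi * \<i> / of_nat (N + 1)) = 2 * of_real pi * \<i>"
    by (simp del: of_nat_Suc of_nat_add)
  finally show ?thesis by simp
qed

lemma eta_nonzero [simp]: "eta N \<noteq> 0"
  by (simp add: eta_def)

lemma eta_power_eq_1_iff: "eta N ^ k = 1 \<longleftrightarrow> (N + 1) dvd k"
proof -
  have "exp (2 * of_real pi * \<i> * of_nat k / of_nat (N + 1)) = eta N ^ k"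
    unfolding eta_def by (simp flip: exp_of_nat_mult add: algebra_simps)
  with complex_root_unity_eq_1[of "N + 1" k] show ?thesis by simp
qed

lemma inj_on_eta_power: "inj_on (\<lambda>j. eta N ^ j) {1..N + 1}"
proof (rule linorder_inj_onI)
  fix i j assume ij: "i < j" "i \<in> {1..N + 1}" "j \<in> {1..N + 1}"
  have "eta N ^ j = eta N ^ i * eta N ^ (j - i)"
    using ij by (simp flip: power_add)
  moreover have "eta N ^ (j - i) \<noteq> 1"
    using ij by (auto simp: eta_power_eq_1_iff dest!: dvd_imp_le)
  ultimately show "eta N ^ i \<noteq> eta N ^ j" by auto
qed auto

lemma prod_linear_factors_eta:
  "(\<Prod>j=1..N+1. [:- (eta N ^ j), 1:]) = monom 1 (N + 1) - 1"
proof (rule poly_eqI_degree_lead_coeff)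
  let ?f = "\<lambda>j. [:- (eta N ^ j), 1:]"
  have deg: "degree (prod ?f {1..N+1}) = N + 1"
    by (subst degree_prod_sum_eq) auto
  then show "coeff (prod ?f {1..N+1}) (N + 1) = coeff (monom 1 (N + 1) - 1) (N + 1)"
    using lead_coeff_prod[of ?f "{1..N+1}"] by (simp del: prod.cl_ivl_Suc)
  show "degree (prod ?f {1..N+1}) \<le> N + 1" using deg by simp
  show "degree (monom 1 (N + 1) - 1 :: complex poly) \<le> N + 1"
    by (intro degree_diff_le degree_monom_le) auto
  show "N + 1 \<le> card ((\<lambda>j. eta N ^ j) ` {1..N + 1})"
    by (subst card_image[OF inj_on_eta_power]) simp
next
  fix z assume "z \<in> (\<lambda>j. eta N ^ j) ` {1..N + 1}"
  then obtain j where j: "j \<in> {1..N + 1}" "z = eta N ^ j" by blast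
  have "z ^ (N + 1) = (eta N ^ (N + 1)) ^ j"
    unfolding j by (simp only: power_mult[symmetric] mult.commute)
  then have "poly (monom 1 (N + 1) - 1) z = 0"
    by (simp only: poly_monom poly_diff poly_1 eta_power_order) simp
  moreover have "poly (\<Prod>j=1..N+1. [:- (eta N ^ j), 1:]) z = 0"
    unfolding poly_prod using j by (intro prod_zero) auto
  ultimately show "poly (\<Prod>j=1..N+1. [:- (eta N ^ j), 1:]) z = poly (monom 1 (N + 1) - 1) z"
    by simp
qed

lemma prod_eta_differences:
  assumes "i \<in> {1..N + 1}"
  shows "(\<Prod>j\<in>{1..N + 1} - {i}. eta N ^ i - eta N ^ j) = of_nat (N + 1) * eta N ^ (i * N)"
proof -
  let ?f = "\<lambda>j. [:- (eta N ^ j), 1:]"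
  have "poly (pderiv (\<Prod>j\<in>{1..N + 1}. ?f j)) (eta N ^ i)
      = (\<Sum>a\<in>{1..N + 1}. poly (prod ?f ({1..N + 1} - {a})) (eta N ^ i))"
    by (simp add: pderiv_prod poly_sum pderiv_pCons del: sum.cl_ivl_Suc prod.cl_ivl_Suc)
  also have "\<dots> = (\<Sum>a\<in>{1..N + 1}. if a = i then poly (prod ?f ({1..N + 1} - {i})) (eta N ^ i) else 0)"
    by (rule sum.cong) (use assms in \<open>auto simp: poly_prod\<close>)
  also have "\<dots> = (\<Prod>j\<in>{1..N + 1} - {i}. eta N ^ i - eta N ^ j)"
    using assms by (simp add: poly_prod del: sum.cl_ivl_Suc)
  finally have "(\<Prod>j\<in>{1..N + 1} - {i}. eta N ^ i - eta N ^ j)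
      = poly (pderiv (monom 1 (N + 1) - 1)) (eta N ^ i)"
    unfolding prod_linear_factors_eta by (rule sym)
  also have "\<dots> = of_nat (N + 1) * eta N ^ (i * N)"
    by (simp add: pderiv_diff pderiv_monom poly_monom power_mult)
  finally show ?thesis .
qed

lemma sum_eta_powi:
  assumes "\<bar>k\<bar> \<le> int N"
  shows "(\<Sum>i=1..N+1. eta N powi (int i * k)) = (if k = 0 then of_nat (N + 1) else 0)"
proof (cases "k = 0")
  case False
  define w where "w = eta N powi k"
  have "w ^ (N + 1) = (eta N ^ (N + 1)) powi k"
    unfolding w_def
    using power_int_mult[of "eta N" k "int (N + 1)"] power_int_mult[of "eta N" "int (N + 1)" k]
    by (simp only: mult.commute power_int_of_nat)
  then have w1: "w ^ (N + 1) = 1"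
    by (simp only: eta_power_order power_int_1_left)
  have "eta N ^ nat \<bar>k\<bar> \<noteq> 1"
    unfolding eta_power_eq_1_iff using assms False by (intro nat_dvd_not_less) auto
  then have "w \<noteq> 1"
    unfolding w_def by (auto simp: power_int_def power_inverse split: if_splits)
  have "(\<Sum>i=1..N+1. w ^ i) = w * (\<Sum>i<N+1. w ^ i)"
    unfolding One_nat_def sum.atLeast_Suc_atMost_Suc_shift add_Suc_right sum_distrib_left
    by (simp add: atLeast0AtMost lessThan_Suc_atMost)
  also have "(\<Sum>i<N+1. w ^ i) = 0"
    using w1 \<open>w \<noteq> 1\<close> by (simp only: sum_gp_strict) simp
  also have "(\<Sum>i=1..N+1. w ^ i) = (\<Sum>i=1..N+1. eta N powi (int i * k))"
    unfolding w_def
    by (intro sum.cong refl) (simp add: mult.commute[of _ k] power_int_mult)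
  finally show ?thesis using False by simp
qed simp

text \<open>
  Multiplied by the missing factors \<open>\<Prod>\<^sub>l\<^sub>\<notin>\<^sub>K (\<eta>\<^sup>i - \<eta>\<^sup>l)\<close>, the denominator becomes \<open>h \<eta>\<^sup>i\<^sup>N\<close>; these factors
  vanish for \<open>i \<notin> K\<close>, so that the sum may be taken over all i and becomes a discrete Fourier sum.
\<close>

lemma sum_over_eta_differences:
  assumes K: "K \<subseteq> {1..N + 1}" "K \<noteq> {}" and a: "a \<in> {1..N}"
  shows "(\<Sum>i\<in>K. eta N powi (- int (i * a)) / (\<Prod>j\<in>K - {i}. eta N ^ i - eta N ^ j))
    = (\<Sum>L | L \<subseteq> {1..N + 1} - K \<and> card L + card K = N + 2 - a. \<Prod>l\<in>L. - (eta N ^ l))"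
proof -
  let ?U = "{1..N + 1}"
  let ?Q = "\<lambda>i. \<Prod>l\<in>?U - K. eta N ^ i - eta N ^ l"
  have fin: "finite K" using K finite_subset by blast
  have cardC: "card (?U - K) = N + 1 - card K"
    using K fin by (simp add: card_Diff_subset)
  have cK: "card K \<ge> 1" using K fin by (simp add: Suc_le_eq card_gt_0_iff)
  have cK': "card K \<le> N + 1" using card_mono[of ?U K] K by simp
  have "(\<Sum>i\<in>K. eta N powi (- int (i * a)) / (\<Prod>j\<in>K - {i}. eta N ^ i - eta N ^ j))
      = (\<Sum>i\<in>K. eta N powi (int i * (1 - int a)) * ?Q i / of_nat (N + 1))"
  proof (rule sum.cong[OF refl])
    fix i assume i: "i \<in> K"
    have "?U - {i} = (K - {i}) \<union> (?U - K)" using i K by auto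
    then have "(\<Prod>j\<in>K - {i}. eta N ^ i - eta N ^ j) * ?Q i
        = (\<Prod>j\<in>?U - {i}. eta N ^ i - eta N ^ j)"
      by (metis (no_types, lifting) Diff_disjoint Diff_subset Int_commute disjoint_iff fin finite_Diff
          finite_atLeastAtMost prod.union_disjoint subset_iff)
    also have "\<dots> = of_nat (N + 1) * eta N ^ (i * N)"
      using i K by (intro prod_eta_differences) auto
    finally have mult: "(\<Prod>j\<in>K - {i}. eta N ^ i - eta N ^ j) * ?Q i = of_nat (N + 1) * eta N ^ (i * N)" .
    then have "?Q i \<noteq> 0"
      by (metis eta_nonzero mult_eq_0_iff of_nat_eq_0_iff power_not_zero add_is_0 one_neq_zero)
    then have den: "(\<Prod>j\<in>K - {i}. eta N ^ i - eta N ^ j) = of_nat (N + 1) * eta N ^ (i * N) / ?Q i"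
      using mult by (metis nonzero_mult_div_cancel_right)
    have "eta N powi (int i * (1 - int a)) * eta N ^ (i * N) = eta N powi (- int (i * a) + int (i * (N + 1)))"
      unfolding power_int_of_nat[symmetric]
      by (subst power_int_add[symmetric]) (auto intro!: arg_cong[where f = "(powi) (eta N)"] simp: algebra_simps)
    also have "\<dots> = eta N powi (- int (i * a)) * (eta N ^ (N + 1)) ^ i"
      by (subst power_int_add) (simp_all only: eta_nonzero power_int_of_nat power_mult[symmetric] mult.commute simp_thms)
    finally have "eta N powi (int i * (1 - int a)) * eta N ^ (i * N) = eta N powi (- int (i * a))"
      by (simp only: eta_power_order) simp
    then have "eta N powi (- int (i * a)) / eta N ^ (i * N) = eta N powi (int i * (1 - int a))"
      by (metis eta_nonzero nonzero_mult_div_cancel_right power_not_zero)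
    then show "eta N powi (- int (i * a)) / (\<Prod>j\<in>K - {i}. eta N ^ i - eta N ^ j)
      = eta N powi (int i * (1 - int a)) * ?Q i / of_nat (N + 1)"
    proof -
      have "x / (n * y / q) = x / y * q / n" for x y n q :: complex by simp
      with den show ?thesis
        using \<open>eta N powi (- int (i * a)) / eta N ^ (i * N) = eta N powi (int i * (1 - int a))\<close> by metis
    qed
  qed
  also have "\<dots> = (\<Sum>i\<in>?U. eta N powi (int i * (1 - int a)) * ?Q i / of_nat (N + 1))"
  proof (rule sum.mono_neutral_left)
    show "\<forall>i\<in>?U - K. eta N powi (int i * (1 - int a)) * ?Q i / of_nat (N + 1) = 0"
    proof
      fix i assume "i \<in> ?U - K"
      then have "?Q i = 0" by (intro prod_zero) auto
      then show "eta N powi (int i * (1 - int a)) * ?Q i / of_nat (N + 1) = 0" by simp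
    qed
  qed (use K in auto)
  also have "\<dots> = (\<Sum>i\<in>?U. \<Sum>L\<in>Pow (?U - K). (\<Prod>l\<in>L. - (eta N ^ l)) * (eta N powi (int i * (int (card (?U - K - L)) + 1 - int a)) / of_nat (N + 1)))"
  proof (rule sum.cong[OF refl])
    fix i
    have "?Q i = (\<Prod>l\<in>?U - K. - (eta N ^ l) + eta N ^ i)" by simp
    also have "\<dots> = (\<Sum>L\<in>Pow (?U - K). (\<Prod>l\<in>L. - (eta N ^ l)) * eta N ^ (i * card (?U - K - L)))"
      by (subst prod_add) (auto simp flip: power_mult)
    finally have Q: "?Q i = (\<Sum>L\<in>Pow (?U - K). (\<Prod>l\<in>L. - (eta N ^ l)) * eta N ^ (i * card (?U - K - L)))" .
    show "eta N powi (int i * (1 - int a)) * ?Q i / of_nat (N + 1)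
      = (\<Sum>L\<in>Pow (?U - K). (\<Prod>l\<in>L. - (eta N ^ l)) * (eta N powi (int i * (int (card (?U - K - L)) + 1 - int a)) / of_nat (N + 1)))"
      unfolding Q sum_distrib_left sum_divide_distrib
    proof (intro sum.cong[OF refl])
      fix L
      have "eta N powi (int i * (1 - int a)) * eta N ^ (i * card (?U - K - L))
          = eta N powi (int i * (int (card (?U - K - L)) + 1 - int a))"
        unfolding power_int_of_nat[symmetric]
        by (subst power_int_add[symmetric]) (auto intro!: arg_cong[where f = "(powi) (eta N)"] simp: algebra_simps)
      then show "eta N powi (int i * (1 - int a)) *
           ((\<Prod>l\<in>L. - (eta N ^ l)) * eta N ^ (i * card (?U - K - L))) / of_nat (N + 1)
        = (\<Prod>l\<in>L. - (eta N ^ l)) *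
           (eta N powi (int i * (int (card (?U - K - L)) + 1 - int a)) / of_nat (N + 1))"
        by (metis mult.left_commute times_divide_eq_right)
    qed
  qed
  also have "\<dots> = (\<Sum>L\<in>Pow (?U - K). (\<Prod>l\<in>L. - (eta N ^ l)) * ((\<Sum>i\<in>?U. eta N powi (int i * (int (card (?U - K - L)) + 1 - int a))) / of_nat (N + 1)))"
    by (subst sum.swap) (simp only: sum_distrib_left sum_divide_distrib)
  also have "\<dots> = (\<Sum>L\<in>Pow (?U - K). if card L + card K = N + 2 - a then \<Prod>l\<in>L. - (eta N ^ l) else 0)"
  proof (rule sum.cong[OF refl])
    fix L assume L: "L \<in> Pow (?U - K)"
    then have "card (?U - K - L) = N + 1 - card K - card L"
      using cardC by (simp add: card_Diff_subset finite_subset)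
    moreover have "card L \<le> N + 1 - card K" using L cardC card_mono[of "?U - K" L] by simp
    ultimately show "(\<Prod>l\<in>L. - (eta N ^ l)) * ((\<Sum>i\<in>?U. eta N powi (int i * (int (card (?U - K - L)) + 1 - int a))) / of_nat (N + 1))
      = (if card L + card K = N + 2 - a then \<Prod>l\<in>L. - (eta N ^ l) else 0)"
      using a cK cK' by (subst sum_eta_powi) (auto simp del: of_nat_Suc)
  qed
  also have "\<dots> = (\<Sum>L | L \<subseteq> ?U - K \<and> card L + card K = N + 2 - a. \<Prod>l\<in>L. - (eta N ^ l))"
    by (subst sum.inter_filter[symmetric]) (auto intro!: sum.cong)
  finally show ?thesis .
qed

section \<open>Normally ordered products as finite sums\<close>

definition local_modes :: "nat \<Rightarrow> monomial \<Rightarrow> mode set" where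
  "local_modes N M = {c \<in> modes N. \<forall>k a. c = Creation k a \<longrightarrow> (k, a) \<in># M \<or> (k, a) = (1, N)}"

definition local_mult :: "nat \<Rightarrow> (nat \<Rightarrow> nat \<Rightarrow> operator) \<Rightarrow> bool" where
  "local_mult N v \<longleftrightarrow> (\<forall>k a f M. v k a f M \<noteq> 0 \<longrightarrow>
     (k, a) \<in># M \<and> f (M - {#(k, a)#}) \<noteq> 0 \<or> (k, a) = (1, N) \<and> f M \<noteq> 0)"

lemma local_mult_t_var: "local_mult N t_var"
  by (auto simp: local_mult_def t_var_def split: if_splits)

lemma local_mult_q_var: "local_mult N (q_var N)"
  by (auto simp: local_mult_def t_var_def q_var_def split: if_splits)

lemma local_modes_mono: "M' \<subseteq># M \<Longrightarrow> local_modes N M' \<subseteq> local_modes N M"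
  by (auto simp: local_modes_def dest: mset_subset_eqD)

lemma foldr_creations_support:
  assumes "local_mult N v" "set cs \<subseteq> modes N" "\<forall>c\<in>set cs. is_creation c"
    and "foldr (mode_op N v) cs g M \<noteq> 0"
  shows "set cs \<subseteq> local_modes N M"
  using assms(2-)
proof (induction cs arbitrary: M)
  case (Cons c cs)
  let ?h = "foldr (mode_op N v) cs g"
  obtain k a where c: "c = Creation k a"
    using Cons.prems by (cases c) auto
  have "v k a ?h M \<noteq> 0"
    using Cons.prems by (auto simp: c x_mult_def fscale_def)
  then consider "(k, a) \<in># M" "?h (M - {#(k, a)#}) \<noteq> 0" | "(k, a) = (1, N)" "?h M \<noteq> 0"
    using assms(1) by (auto simp: local_mult_def)
  then show ?case
  proof cases
    case 1
    then have "set cs \<subseteq> local_modes N (M - {#(k, a)#})"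
      using Cons by auto
    with 1 Cons.prems show ?thesis
      using local_modes_mono[of "M - {#(k, a)#}" M N] by (auto simp: c local_modes_def)
  next
    case 2
    then have "set cs \<subseteq> local_modes N M" using Cons by auto
    with 2 Cons.prems show ?thesis by (auto simp: c local_modes_def)
  qed
qed simp

lemma normal_ordered_modes_support:
  assumes "local_mult N v" "set cs \<subseteq> modes N" "normal_ordered_modes N v cs f M \<noteq> 0"
  shows "set cs \<subseteq> local_modes N M"
proof -
  have "set (filter is_creation cs) \<subseteq> local_modes N M"
    using assms by (intro foldr_creations_support[OF assms(1)]) (auto simp: normal_ordered_modes_def)
  moreover have "c \<in> local_modes N M" if "c \<in> modes N" "\<not> is_creation c" for c
    using that by (auto simp: local_modes_def)
  ultimately show ?thesis using assms(2) by auto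
qed

definition assignments :: "nat \<Rightarrow> monomial \<Rightarrow> nat set \<Rightarrow> rat \<Rightarrow> (nat \<Rightarrow> mode) set" where
  "assignments N M S p =
     {\<phi> \<in> S \<rightarrow>\<^sub>E local_modes N M. (\<Sum>j\<in>S. mode_exponent N (\<phi> j)) = p}"

text \<open>
  The creation modes of bounded exponent form a finite set, so that a prescribed total exponent
  bounds the exponents of the annihilation modes from below.
\<close>

lemma finite_assignments:
  assumes "finite S"
  shows "finite (assignments N M S p)"
proof -
  define C where "C = insert (1, N) (set_mset M)"
  define B :: rat where "B = of_nat (Max (fst ` C))"
  have exp_le: "mode_exponent N c \<le> B" if "c \<in> local_modes N M" for c
  proof (cases c)
    case (Creation k a)
    then have "k \<le> Max (fst ` C)"
      using that by (intro Max_ge) (auto simp: local_modes_def C_def image_iff intro: bexI[of _ "(k, a)"])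
    then have "(of_nat k :: rat) \<le> B" by (simp add: B_def)
    moreover have "0 \<le> of_nat a / (of_nat (N + 1) :: rat)" by simp
    ultimately have "of_nat k - of_nat a / of_nat (N + 1) \<le> B" by linarith
    then show ?thesis by (simp add: Creation)
  next
    case (Annihilation k a)
    have "0 \<le> of_nat a / (of_nat (N + 1) :: rat)" "0 \<le> B" by (simp_all add: B_def)
    then have "- of_nat k - 1 - of_nat a / of_nat (N + 1) \<le> B" by linarith
    then show ?thesis by (simp add: Annihilation)
  qed
  define D where "D = (\<lambda>(k, a). Creation k a) ` C \<union>
    (\<lambda>(k, a). Annihilation k a) ` ({k. of_nat k \<le> of_nat (card S) * B - p} \<times> {1..N})"
  have "finite {k::nat. of_nat k \<le> of_nat (card S) * B - p}"
  proof (rule finite_subset)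
    show "{k::nat. of_nat k \<le> of_nat (card S) * B - p} \<subseteq> {..nat \<lceil>of_nat (card S) * B - p\<rceil>}"
      by (auto simp: le_nat_iff) linarith
  qed simp
  then have "finite D" by (simp add: D_def C_def)
  moreover have "assignments N M S p \<subseteq> S \<rightarrow>\<^sub>E D"
  proof
    fix \<phi> assume "\<phi> \<in> assignments N M S p"
    then have \<phi>: "\<phi> \<in> S \<rightarrow>\<^sub>E local_modes N M" and sum: "(\<Sum>j\<in>S. mode_exponent N (\<phi> j)) = p"
      by (auto simp: assignments_def)
    have "\<phi> j \<in> D" if j: "j \<in> S" for j
    proof (cases "\<phi> j")
      case (Creation k a)
      moreover have "\<phi> j \<in> local_modes N M" using \<phi> j by auto
      ultimately show ?thesis by (force simp: D_def C_def local_modes_def)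
    next
      case (Annihilation k a)
      have loc: "\<phi> i \<in> local_modes N M" if "i \<in> S" for i using \<phi> that by auto
      have a: "a \<in> {1..N}" using loc[OF j] Annihilation by (auto simp: local_modes_def modes_def)
      have "(\<Sum>i\<in>S - {j}. mode_exponent N (\<phi> i)) \<le> of_nat (card (S - {j})) * B"
        using loc by (intro sum_bounded_above) (auto intro: exp_le)
      also have "\<dots> \<le> of_nat (card S) * B"
        using assms by (intro mult_right_mono) (auto simp: B_def card_mono)
      finally have "p \<le> mode_exponent N (\<phi> j) + of_nat (card S) * B"
        using sum sum.remove[OF assms j, of "\<lambda>j. mode_exponent N (\<phi> j)"] by simp
      moreover have "0 \<le> of_nat a / (of_nat (N + 1) :: rat)" by simp
      ultimately have "of_nat k \<le> of_nat (card S) * B - p"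
        unfolding Annihilation mode_exponent.simps by linarith
      then show ?thesis using a by (auto simp: Annihilation D_def)
    qed
    with \<phi> show "\<phi> \<in> S \<rightarrow>\<^sub>E D" by (auto simp: PiE_iff)
  qed
  ultimately show ?thesis
    using assms finite_PiE[of S "\<lambda>_. D"] finite_subset by blast
qed

definition assignment_term ::
    "nat \<Rightarrow> (nat \<Rightarrow> nat \<Rightarrow> operator) \<Rightarrow> nat set \<Rightarrow> formal_fun \<Rightarrow> monomial \<Rightarrow> (nat \<Rightarrow> mode) \<Rightarrow> complex fls" where
  "assignment_term N v S f M \<phi> = (\<Prod>j\<in>S. mode_coeff N j (\<phi> j)) *
     normal_ordered_modes N v (map \<phi> (sorted_list_of_set S)) f M"

lemma ex_map_eq_if_distinct:
  assumes "distinct xs" "length ys = length xs"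
  shows "\<exists>\<phi>. map \<phi> xs = ys"
  using assms(2,1)
proof (induction ys xs rule: list_induct2)
  case (Cons y ys x xs)
  then obtain \<phi> where "map \<phi> xs = ys" by auto
  with Cons.prems have "map (\<phi>(x := y)) (x # xs) = y # ys" by (auto intro!: map_cong)
  then show ?case by (rule exI[of _ "\<phi>(x := y)"])
qed simp

lemma normal_product_eq_sum_assignments:
  assumes "finite S" "local_mult N v"
  shows "normal_product N v S p f M = (\<Sum>\<phi>\<in>assignments N M S p. assignment_term N v S f M \<phi>)"
proof -
  define js where "js = sorted_list_of_set S"
  define T where "T = (\<lambda>cs. prod_list (map2 (mode_coeff N) js cs) * normal_ordered_modes N v cs f M)"
  define A where "A = {cs. length cs = length js \<and> set cs \<subseteq> modes N \<and>
    sum_list (map (mode_exponent N) cs) = p}"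
  define g where "g = (\<lambda>\<phi>::nat \<Rightarrow> mode. map \<phi> js)"
  have js: "distinct js" "set js = S"
    using assms by (simp_all add: js_def)
  have sum_js: "sum_list (map (mode_exponent N) (g \<phi>)) = (\<Sum>j\<in>S. mode_exponent N (\<phi> j))" for \<phi>
    unfolding g_def js(2)[symmetric] by (subst sum.distinct_set_conv_list[OF js(1)]) (simp add: o_def)
  have T_g: "T (g \<phi>) = assignment_term N v S f M \<phi>" for \<phi>
  proof -
    have "map2 (mode_coeff N) js (map \<phi> js) = map (\<lambda>j. mode_coeff N j (\<phi> j)) js"
      by (induction js) auto
    moreover have "prod_list (map (\<lambda>j. mode_coeff N j (\<phi> j)) js) = (\<Prod>j\<in>S. mode_coeff N j (\<phi> j))"
      unfolding js(2)[symmetric] by (rule prod.distinct_set_conv_list[OF js(1), symmetric])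
    ultimately show ?thesis
      unfolding T_def g_def assignment_term_def js_def[symmetric] by simp
  qed
  have "normal_product N v S p f M = (\<Sum>cs | cs \<in> A \<and> T cs \<noteq> 0. T cs)"
    unfolding normal_product_def op_sum_def fscale_def Let_def js_def[symmetric] A_def T_def by simp
  also have "\<dots> = (\<Sum>cs\<in>g ` assignments N M S p. T cs)"
  proof (rule sum.mono_neutral_left)
    show "finite (g ` assignments N M S p)" using assms by (simp add: finite_assignments)
    show "{cs. cs \<in> A \<and> T cs \<noteq> 0} \<subseteq> g ` assignments N M S p"
    proof safe
      fix cs assume cs: "cs \<in> A" "T cs \<noteq> 0"
      obtain \<psi> where \<psi>: "map \<psi> js = cs"
        using cs js ex_map_eq_if_distinct[of js cs] by (auto simp: A_def)
      define \<phi> where "\<phi> = restrict \<psi> S"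
      have g: "g \<phi> = cs" unfolding g_def \<phi>_def \<psi>[symmetric] using js by auto
      have "set cs \<subseteq> local_modes N M"
        using cs by (intro normal_ordered_modes_support[OF assms(2)]) (auto simp: A_def T_def)
      then have "\<phi> \<in> S \<rightarrow>\<^sub>E local_modes N M"
        using js by (auto simp: \<phi>_def \<psi>[symmetric])
      moreover have "(\<Sum>j\<in>S. mode_exponent N (\<phi> j)) = p"
        using cs sum_js[of \<phi>] g by (simp add: A_def)
      ultimately have "\<phi> \<in> assignments N M S p" by (simp add: assignments_def)
      with g show "cs \<in> g ` assignments N M S p" by blast
    qed
    have "g \<phi> \<in> A" if "\<phi> \<in> assignments N M S p" for \<phi>
      using that sum_js[of \<phi>] js by (auto simp: A_def assignments_def g_def local_modes_def PiE_iff)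
    then show "\<forall>cs\<in>g ` assignments N M S p - {cs. cs \<in> A \<and> T cs \<noteq> 0}. T cs = 0"
      by blast
  qed
  also have "\<dots> = (\<Sum>\<phi>\<in>assignments N M S p. T (g \<phi>))"
  proof (subst sum.reindex)
    show "inj_on g (assignments N M S p)"
      using js by (intro inj_onI PiE_ext[of _ S "\<lambda>_. local_modes N M"]) (auto simp: g_def assignments_def)
  qed simp
  finally show ?thesis by (simp add: T_g)
qed

section \<open>The dilaton shift\<close>

text \<open>
  On the mode \<open>Creation 1 N\<close>, and only there, the dilaton shift adds a scalar to the operator.
\<close>

definition dilaton_coeff :: "nat \<Rightarrow> nat \<Rightarrow> complex fls" where
  "dilaton_coeff N j = - mode_coeff N j (Creation 1 N)"

lemma mode_op_q_var:
  "mode_op N (q_var N) c h M = mode_op N t_var c h M - (if c = Creation 1 N then h M else 0)"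
  by (cases c) (auto simp: x_mult_def q_var_def fscale_def x_factor_def algebra_simps)

lemma mode_op_sum:
  assumes "finite A"
  shows "mode_op N t_var c (\<lambda>M. \<Sum>i\<in>A. s i * F i M) M = (\<Sum>i\<in>A. s i * mode_op N t_var c (F i) M)"
  by (cases c) (auto simp: x_mult_def x_diff_def t_var_def t_diff_def fscale_def sum_distrib_left algebra_simps)

lemma foldr_creations_q_var:
  fixes js :: "nat list"
  assumes "distinct js"
  shows "foldr (mode_op N (q_var N)) (filter is_creation (map \<phi> js)) g M =
    (\<Sum>K\<in>Pow (set js). (\<Prod>i\<in>set js - K. if \<phi> i = Creation 1 N then -1 else 0) *
       foldr (mode_op N t_var) (filter is_creation (map \<phi> (filter (\<lambda>j. j \<in> K) js))) g M)"
  using assms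
proof (induction js arbitrary: M)
  case (Cons j js)
  define s :: "nat \<Rightarrow> complex fls" where "s = (\<lambda>i. if \<phi> i = Creation 1 N then -1 else 0)"
  define F where "F = (\<lambda>K. foldr (mode_op N t_var) (filter is_creation (map \<phi> (filter (\<lambda>j. j \<in> K) js))) g)"
  define h where "h = (\<lambda>M. \<Sum>K\<in>Pow (set js). (\<Prod>i\<in>set js - K. s i) * F K M)"
  let ?G = "\<lambda>K. (\<Prod>i\<in>set (j # js) - K. s i) *
    foldr (mode_op N t_var) (filter is_creation (map \<phi> (filter (\<lambda>j. j \<in> K) (j # js)))) g M"
  have j: "j \<notin> set js" using Cons.prems by simp
  have IH: "foldr (mode_op N (q_var N)) (filter is_creation (map \<phi> js)) g = h"
    unfolding h_def F_def s_def using Cons by (intro ext) simp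
  have without: "?G K = s j * ((\<Prod>i\<in>set js - K. s i) * F K M)" if "K \<in> Pow (set js)" for K
  proof -
    have "set (j # js) - K = insert j (set js - K)" "j \<notin> K" using that j by auto
    then show ?thesis using j by (simp add: F_def mult.assoc)
  qed
  have inserted: "?G (insert j K) = (\<Prod>i\<in>set js - K. s i) *
      (if is_creation (\<phi> j) then mode_op N t_var (\<phi> j) (F K) M else F K M)" if "K \<in> Pow (set js)" for K
  proof -
    have "set (j # js) - insert j K = set js - K" using j by auto
    moreover have "filter (\<lambda>i. i \<in> insert j K) js = filter (\<lambda>i. i \<in> K) js"
      using j by (intro filter_cong) auto
    ultimately show ?thesis by (auto simp: F_def)
  qed
  have "(\<Sum>K\<in>Pow (set (j # js)). ?G K) = (\<Sum>K\<in>Pow (set js). ?G K) + (\<Sum>K\<in>insert j ` Pow (set js). ?G K)"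
    unfolding list.set Pow_insert by (intro sum.union_disjoint) (use j in auto)
  also have "(\<Sum>K\<in>insert j ` Pow (set js). ?G K) = (\<Sum>K\<in>Pow (set js). ?G (insert j K))"
    by (subst sum.reindex) (use j in \<open>auto simp: inj_on_def\<close>)
  also have "(\<Sum>K\<in>Pow (set js). ?G K) = s j * h M"
    unfolding h_def sum_distrib_left by (intro sum.cong refl without)
  also have "(\<Sum>K\<in>Pow (set js). ?G (insert j K)) = (\<Sum>K\<in>Pow (set js). (\<Prod>i\<in>set js - K. s i) *
      (if is_creation (\<phi> j) then mode_op N t_var (\<phi> j) (F K) M else F K M))"
    by (intro sum.cong refl inserted)
  also have "\<dots> = (if is_creation (\<phi> j) then mode_op N t_var (\<phi> j) h M else h M)"
    unfolding h_def by (simp add: mode_op_sum)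
  also have "s j * h M + \<dots> = foldr (mode_op N (q_var N)) (filter is_creation (map \<phi> (j # js))) g M"
    by (auto simp: IH mode_op_q_var s_def)
  finally show ?case by (simp only: s_def)
qed simp

lemma normal_ordered_modes_q_var:
  fixes S :: "nat set"
  assumes "finite S"
  shows "normal_ordered_modes N (q_var N) (map \<phi> (sorted_list_of_set S)) f M =
    (\<Sum>K\<in>Pow S. (\<Prod>i\<in>S - K. if \<phi> i = Creation 1 N then -1 else 0) *
       normal_ordered_modes N t_var (map \<phi> (sorted_list_of_set K)) f M)"
proof -
  define js where "js = sorted_list_of_set S"
  have js: "distinct js" "set js = S" using assms by (auto simp: js_def)
  let ?s = "\<lambda>i. if \<phi> i = Creation 1 N then -1 else 0 :: complex fls"
  let ?an = "filter (\<lambda>c. \<not> is_creation c)"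
  have an: "mode_op N (q_var N) c = mode_op N t_var c" if "\<not> is_creation c" for c
    using that by (cases c) auto
  define g where "g = foldr (mode_op N t_var) (?an (map \<phi> js)) f"
  have g: "foldr (mode_op N (q_var N)) (?an (map \<phi> js)) f = g"
    unfolding g_def by (rule foldr_cong) (auto simp: an)
  have "normal_ordered_modes N (q_var N) (map \<phi> js) f M =
    (\<Sum>K\<in>Pow S. (\<Prod>i\<in>S - K. ?s i) *
       foldr (mode_op N t_var) (filter is_creation (map \<phi> (filter (\<lambda>j. j \<in> K) js))) g M)"
    unfolding normal_ordered_modes_def foldr_append g
    using foldr_creations_q_var[OF js(1), of N \<phi> g M] js(2) by simp
  also have "\<dots> = (\<Sum>K\<in>Pow S. (\<Prod>i\<in>S - K. ?s i) *
       normal_ordered_modes N t_var (map \<phi> (sorted_list_of_set K)) f M)"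
  proof (intro sum.cong refl)
    fix K assume K: "K \<in> Pow S"
    have sorted_K: "sorted_list_of_set K = filter (\<lambda>j. j \<in> K) js"
      using K assms finite_subset[of K S]
      by (intro sorted_distinct_set_unique) (auto simp: js_def intro!: sorted_wrt_filter)
    show "(\<Prod>i\<in>S - K. ?s i) *
        foldr (mode_op N t_var) (filter is_creation (map \<phi> (filter (\<lambda>j. j \<in> K) js))) g M =
      (\<Prod>i\<in>S - K. ?s i) * normal_ordered_modes N t_var (map \<phi> (sorted_list_of_set K)) f M"
    proof (cases "\<forall>i\<in>S - K. \<phi> i = Creation 1 N")
      case True
      have "?an (map \<phi> (filter (\<lambda>j. j \<in> K) js)) = ?an (map \<phi> js)"
        using True js(2) by (induction js arbitrary: S) (auto simp: subset_iff)
      then show ?thesis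
        by (simp add: normal_ordered_modes_def sorted_K g_def)
    next
      case False
      then have "(\<Prod>i\<in>S - K. ?s i) = 0" using assms by (intro prod_zero) auto
      then show ?thesis by simp
    qed
  qed
  finally show ?thesis by (simp add: js_def)
qed

lemma sum_assignments_extend:
  assumes "finite S" "K \<subseteq> S" "N \<ge> 1"
    and vanish: "\<And>\<phi> i. i \<in> S - K \<Longrightarrow> \<phi> i \<noteq> Creation 1 N \<Longrightarrow> F \<phi> = 0"
  shows "(\<Sum>\<phi>\<in>assignments N M S p. F \<phi>) =
    (\<Sum>\<psi>\<in>assignments N M K (p - of_nat (card (S - K)) / of_nat (N + 1)).
       F (\<lambda>i. if i \<in> S - K then Creation 1 N else \<psi> i))"
proof -
  define ext where "ext = (\<lambda>\<psi> i. if i \<in> S - K then Creation 1 N else \<psi> i :: mode)"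
  let ?p' = "p - of_nat (card (S - K)) / of_nat (N + 1)"
  have disj: "S = K \<union> (S - K)" using assms by auto
  have fin: "finite K" "finite (S - K)" using assms finite_subset by auto
  have loc: "Creation 1 N \<in> local_modes N M"
    using assms by (auto simp: local_modes_def modes_def)
  have exp1: "mode_exponent N (Creation 1 N) = 1 / of_nat (N + 1)"
    by (simp add: field_simps)
  have total: "(\<Sum>j\<in>S. mode_exponent N (ext \<psi> j)) =
      (\<Sum>j\<in>K. mode_exponent N (\<psi> j)) + of_nat (card (S - K)) / of_nat (N + 1)" for \<psi>
  proof -
    have "(\<Sum>j\<in>S. mode_exponent N (ext \<psi> j)) =
        (\<Sum>j\<in>K. mode_exponent N (ext \<psi> j)) + (\<Sum>j\<in>S - K. mode_exponent N (ext \<psi> j))"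
      using fin by (subst disj, subst sum.union_disjoint) auto
    also have "(\<Sum>j\<in>K. mode_exponent N (ext \<psi> j)) = (\<Sum>j\<in>K. mode_exponent N (\<psi> j))"
      by (intro sum.cong) (auto simp: ext_def)
    also have "(\<Sum>j\<in>S - K. mode_exponent N (ext \<psi> j)) = (\<Sum>j\<in>S - K. 1 / of_nat (N + 1))"
      by (intro sum.cong refl) (simp only: ext_def exp1 if_True)
    finally show ?thesis by simp
  qed
  have "(\<Sum>\<phi>\<in>assignments N M S p. F \<phi>) = (\<Sum>\<phi>\<in>ext ` assignments N M K ?p'. F \<phi>)"
  proof (rule sum.mono_neutral_right)
    show "finite (assignments N M S p)" using assms by (simp add: finite_assignments)
    show "ext ` assignments N M K ?p' \<subseteq> assignments N M S p"
    proof safe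
      fix \<psi> assume \<psi>: "\<psi> \<in> assignments N M K ?p'"
      then have "ext \<psi> \<in> S \<rightarrow>\<^sub>E local_modes N M"
        using loc assms(2) by (auto simp: assignments_def ext_def PiE_iff extensional_def)
      with \<psi> total[of \<psi>] show "ext \<psi> \<in> assignments N M S p"
        by (simp add: assignments_def)
    qed
    show "\<forall>\<phi>\<in>assignments N M S p - ext ` assignments N M K ?p'. F \<phi> = 0"
    proof
      fix \<phi> assume \<phi>: "\<phi> \<in> assignments N M S p - ext ` assignments N M K ?p'"
      have "\<exists>i\<in>S - K. \<phi> i \<noteq> Creation 1 N"
      proof (rule ccontr)
        assume "\<not> ?thesis"
        then have "ext (restrict \<phi> K) = \<phi>"
          using \<phi> assms(2) by (intro ext) (auto simp: ext_def assignments_def PiE_iff extensional_def)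
        moreover have "restrict \<phi> K \<in> assignments N M K ?p'"
          using \<phi> assms(2) total[of "restrict \<phi> K"] calculation
          by (auto simp: assignments_def PiE_iff)
        ultimately show False using \<phi> by (metis DiffD2 imageI)
      qed
      then show "F \<phi> = 0" using vanish by blast
    qed
  qed
  also have "\<dots> = (\<Sum>\<psi>\<in>assignments N M K ?p'. F (ext \<psi>))"
  proof (subst sum.reindex)
    show "inj_on ext (assignments N M K ?p')"
    proof (rule inj_onI)
      fix \<psi> \<psi>' assume *: "\<psi> \<in> assignments N M K ?p'" "\<psi>' \<in> assignments N M K ?p'" "ext \<psi> = ext \<psi>'"
      show "\<psi> = \<psi>'"
      proof (rule PiE_ext[of _ K "\<lambda>_. local_modes N M"])
        fix i assume "i \<in> K"
        with fun_cong[OF *(3), of i] show "\<psi> i = \<psi>' i" by (simp add: ext_def)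
      qed (use * in \<open>auto simp: assignments_def\<close>)
    qed
  qed simp
  finally show ?thesis by (simp only: ext_def)
qed

lemma normal_product_q_var:
  assumes "finite S" "N \<ge> 1"
  shows "normal_product N (q_var N) S p f M = (\<Sum>K\<in>Pow S. (\<Prod>j\<in>S - K. dilaton_coeff N j) *
    normal_product N t_var K (p - of_nat (card (S - K)) / of_nat (N + 1)) f M)"
proof -
  let ?s = "\<lambda>\<phi> i. if \<phi> i = Creation 1 N then -1 else 0 :: complex fls"
  define T where "T = (\<lambda>K \<phi>. (\<Prod>j\<in>S. mode_coeff N j (\<phi> j)) * ((\<Prod>i\<in>S - K. ?s \<phi> i) *
       normal_ordered_modes N t_var (map \<phi> (sorted_list_of_set K)) f M))"
  have "normal_product N (q_var N) S p f M = (\<Sum>\<phi>\<in>assignments N M S p. \<Sum>K\<in>Pow S. T K \<phi>)"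
    unfolding normal_product_eq_sum_assignments[OF assms(1) local_mult_q_var]
      assignment_term_def normal_ordered_modes_q_var[OF assms(1)] sum_distrib_left T_def ..
  also have "\<dots> = (\<Sum>K\<in>Pow S. \<Sum>\<phi>\<in>assignments N M S p. T K \<phi>)"
    by (rule sum.swap)
  also have "\<dots> = (\<Sum>K\<in>Pow S. (\<Prod>j\<in>S - K. dilaton_coeff N j) *
    normal_product N t_var K (p - of_nat (card (S - K)) / of_nat (N + 1)) f M)"
  proof (intro sum.cong refl)
    fix K assume "K \<in> Pow S"
    then have K: "K \<subseteq> S" and fin: "finite K" "finite (S - K)" using assms finite_subset by auto
    have disj: "S = K \<union> (S - K)" using K by auto
    have vanish: "T K \<phi> = 0" if "i \<in> S - K" "\<phi> i \<noteq> Creation 1 N" for \<phi> i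
    proof -
      have "(\<Prod>i\<in>S - K. ?s \<phi> i) = 0" using that fin by (intro prod_zero) auto
      then show ?thesis by (simp add: T_def)
    qed
    have extended: "T K (\<lambda>i. if i \<in> S - K then Creation 1 N else \<psi> i) =
        (\<Prod>j\<in>S - K. dilaton_coeff N j) * assignment_term N t_var K f M \<psi>" for \<psi>
    proof -
      let ?e = "\<lambda>i. if i \<in> S - K then Creation 1 N else \<psi> i"
      have "(\<Prod>j\<in>S. mode_coeff N j (?e j)) =
          (\<Prod>j\<in>K. mode_coeff N j (?e j)) * (\<Prod>j\<in>S - K. mode_coeff N j (?e j))"
        using fin by (subst disj, subst prod.union_disjoint) auto
      moreover have "(\<Prod>j\<in>K. mode_coeff N j (?e j)) = (\<Prod>j\<in>K. mode_coeff N j (\<psi> j))"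
        by (intro prod.cong) auto
      moreover have "(\<Prod>j\<in>S - K. mode_coeff N j (?e j)) * (\<Prod>i\<in>S - K. ?s ?e i) =
          (\<Prod>j\<in>S - K. dilaton_coeff N j)"
        unfolding prod.distrib[symmetric] dilaton_coeff_def by (intro prod.cong) auto
      moreover have "map ?e (sorted_list_of_set K) = map \<psi> (sorted_list_of_set K)"
        using fin by (intro map_cong) auto
      ultimately show ?thesis
        unfolding T_def assignment_term_def by (simp only: mult_ac)
    qed
    have "(\<Sum>\<phi>\<in>assignments N M S p. T K \<phi>) =
      (\<Sum>\<psi>\<in>assignments N M K (p - of_nat (card (S - K)) / of_nat (N + 1)).
        T K (\<lambda>i. if i \<in> S - K then Creation 1 N else \<psi> i))"
      using assms K vanish by (intro sum_assignments_extend) auto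
    then show "(\<Sum>\<phi>\<in>assignments N M S p. T K \<phi>) = (\<Prod>j\<in>S - K. dilaton_coeff N j) *
      normal_product N t_var K (p - of_nat (card (S - K)) / of_nat (N + 1)) f M"
      unfolding extended normal_product_eq_sum_assignments[OF fin(1) local_mult_t_var] sum_distrib_left .
  qed
  finally show ?thesis .
qed

lemma finite_pairings: "finite J \<Longrightarrow> finite (pairings J)"
  by (rule finite_subset[of _ "Pow (J \<times> J)"]) (auto simp: pairings_def)

lemma pairings_support: "\<pi> \<in> pairings J \<Longrightarrow> fst ` \<pi> \<union> snd ` \<pi> \<subseteq> J"
  by (auto simp: pairings_def)

lemma pairings_subset_iff:
  assumes "K \<subseteq> J"
  shows "\<pi> \<in> pairings K \<longleftrightarrow> \<pi> \<in> pairings J \<and> fst ` \<pi> \<union> snd ` \<pi> \<subseteq> K"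
proof -
  have ordered: "\<pi> \<subseteq> {(i, j). i \<in> L \<and> j \<in> L \<and> i < j} \<longleftrightarrow>
      (\<forall>p\<in>\<pi>. fst p \<in> L \<and> snd p \<in> L \<and> fst p < snd p)" for L :: "nat set"
    by (simp add: subset_eq case_prod_unfold)
  have support: "fst ` \<pi> \<union> snd ` \<pi> \<subseteq> K \<longleftrightarrow> (\<forall>p\<in>\<pi>. fst p \<in> K \<and> snd p \<in> K)"
    by (simp add: image_subset_iff ball_conj_distrib)
  show ?thesis
    unfolding pairings_def mem_Collect_eq ordered support using assms by blast
qed

lemma X_field_q_var:
  assumes "finite J" "N \<ge> 1"
  shows "X_field N (q_var N) J p f M = (\<Sum>K\<in>Pow J. (\<Prod>j\<in>J - K. dilaton_coeff N j) *
    X_field N t_var K (p - of_nat (card (J - K)) / of_nat (N + 1)) f M)"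
proof -
  let ?s = "\<lambda>\<pi>::(nat \<times> nat) set. fst ` \<pi> \<union> snd ` \<pi>"
  let ?P = "\<lambda>\<pi>. fls_const (\<Prod>(i, j)\<in>\<pi>. P_coeff N i j)"
  let ?T = "\<lambda>\<pi> L S. ?P \<pi> * ((\<Prod>j\<in>L. dilaton_coeff N j) *
    normal_product N t_var S (p + 2 * of_nat (card \<pi>) - of_nat (card L) / of_nat (N + 1)) f M)"
  have "X_field N (q_var N) J p f M =
      (\<Sum>\<pi>\<in>pairings J. \<Sum>S\<in>Pow (J - ?s \<pi>). ?T \<pi> (J - ?s \<pi> - S) S)"
    unfolding X_field_def fscale_def lambda_times_def
    using assms by (intro sum.cong refl) (simp add: normal_product_q_var sum_distrib_left)
  also have "\<dots> = (\<Sum>(\<pi>, S)\<in>(SIGMA \<pi>:pairings J. Pow (J - ?s \<pi>)). ?T \<pi> (J - ?s \<pi> - S) S)"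
    using assms by (intro sum.Sigma) (auto simp: finite_pairings)
  also have "\<dots> = (\<Sum>(K, \<pi>)\<in>(SIGMA K:Pow J. pairings K). ?T \<pi> (J - K) (K - ?s \<pi>))"
  proof (rule sum.reindex_bij_witness[where j = "\<lambda>(\<pi>, S). (S \<union> ?s \<pi>, \<pi>)"
        and i = "\<lambda>(K, \<pi>). (\<pi>, K - ?s \<pi>)"], goal_cases)
    case (1 x)
    then show ?case by auto
  next
    case (2 x)
    obtain \<pi> S where x: "x = (\<pi>, S)" by fastforce
    with 2 have "\<pi> \<in> pairings J" "S \<subseteq> J - ?s \<pi>" by auto
    moreover from this pairings_support have "?s \<pi> \<subseteq> J" by blast
    ultimately show ?case unfolding x
      using pairings_subset_iff[of "S \<union> ?s \<pi>" J \<pi>] by auto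
  next
    case (3 x)
    obtain K \<pi> where x: "x = (K, \<pi>)" by fastforce
    with 3 pairings_support[of \<pi> K] show ?case by auto
  next
    case (4 x)
    obtain K \<pi> where x: "x = (K, \<pi>)" by fastforce
    with 4 pairings_subset_iff[of K J \<pi>] show ?case by auto
  next
    case (5 x)
    obtain \<pi> S where x: "x = (\<pi>, S)" by fastforce
    with 5 have "S \<union> ?s \<pi> - ?s \<pi> = S" "J - (S \<union> ?s \<pi>) = J - ?s \<pi> - S" by auto
    then show ?case unfolding x by (simp only: prod.case)
  qed
  also have "\<dots> = (\<Sum>K\<in>Pow J. \<Sum>\<pi>\<in>pairings K. ?T \<pi> (J - K) (K - ?s \<pi>))"
    using assms by (intro sum.Sigma[symmetric]) (auto intro: finite_pairings finite_subset)
  also have "\<dots> = (\<Sum>K\<in>Pow J. (\<Prod>j\<in>J - K. dilaton_coeff N j) *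
    X_field N t_var K (p - of_nat (card (J - K)) / of_nat (N + 1)) f M)"
    unfolding X_field_def fscale_def lambda_times_def sum_distrib_left
    by (intro sum.cong refl) (simp add: mult_ac diff_diff_eq2 algebra_simps)
  finally show ?thesis .
qed

lemma X_field_empty:
  assumes "p \<noteq> 0"
  shows "X_field N t_var {} p f M = 0"
proof -
  have "pairings {} = {{}}" by (auto simp: pairings_def)
  moreover have "assignments N M {} p = {}" using assms by (auto simp: assignments_def)
  ultimately show ?thesis
    by (simp add: X_field_def lambda_times_def fscale_def
        normal_product_eq_sum_assignments[OF _ local_mult_t_var])
qed

lemma mode_exponent_eq_annihilation_iff:
  assumes "c \<in> modes N" "b \<in> {1..N}"
  shows "mode_exponent N c = mode_exponent N (Annihilation m b) \<longleftrightarrow> c = Annihilation m b"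
proof -
  have unit: "0 < of_nat a / (of_nat (N + 1) :: rat)" "of_nat a / (of_nat (N + 1) :: rat) < 1"
    if "a \<in> {1..N}" for a
    using that by (auto simp: field_simps simp del: of_nat_add of_nat_Suc)
  show ?thesis
  proof (cases c)
    case (Creation k a)
    then have "a \<in> {1..N}" using assms by (auto simp: modes_def)
    then have "mode_exponent N c > - 1" using unit[of a] unfolding Creation mode_exponent.simps
      using \<open>a \<in> {1..N}\<close> of_nat_0_le_iff[of k, where 'a = rat] by linarith
    moreover have "mode_exponent N (Annihilation m b) < - 1" unfolding mode_exponent.simps
      using unit[of b] assms(2) of_nat_0_le_iff[of m, where 'a = rat] by linarith
    ultimately show ?thesis using Creation by auto
  next
    case (Annihilation k a)
    then have a: "a \<in> {1..N}" using assms by (auto simp: modes_def)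
    have "k = m \<and> a = b" if eq: "mode_exponent N c = mode_exponent N (Annihilation m b)"
    proof -
      have "of_nat k + of_nat a / of_nat (N + 1) = (of_nat m + of_nat b / of_nat (N + 1) :: rat)"
        using eq unfolding Annihilation mode_exponent.simps by linarith
      then have "(of_nat (k * (N + 1) + a) :: rat) = of_nat (m * (N + 1) + b)"
        by (simp add: field_simps)
      then have *: "k * (N + 1) + a = m * (N + 1) + b" by (simp only: of_nat_eq_iff)
      have "k = (k * (N + 1) + a) div (N + 1)" "m = (m * (N + 1) + b) div (N + 1)"
        using a assms by (simp_all del: add_Suc_right)
      with * have "k = m" by metis
      with * show ?thesis by simp
    qed
    then show ?thesis using Annihilation by auto
  qed
qed

lemma X_field_singleton_annihilation:
  assumes "b \<in> {1..N}"
  shows "X_field N t_var {i} (mode_exponent N (Annihilation m b)) f M =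
    mode_coeff N i (Annihilation m b) * mode_op N t_var (Annihilation m b) f M"
proof -
  have "pairings {i} = {{}}" by (auto simp: pairings_def)
  moreover have "assignments N M {i} (mode_exponent N (Annihilation m b)) = {restrict (\<lambda>_. Annihilation m b) {i}}"
  proof -
    have loc: "local_modes N M \<subseteq> modes N" "Annihilation m b \<in> local_modes N M"
      using assms by (auto simp: local_modes_def modes_def)
    show ?thesis
    proof (intro equalityI subsetI)
      fix \<phi> assume "\<phi> \<in> assignments N M {i} (mode_exponent N (Annihilation m b))"
      then have \<phi>: "\<phi> \<in> {i} \<rightarrow>\<^sub>E local_modes N M"
        and "mode_exponent N (\<phi> i) = mode_exponent N (Annihilation m b)"
        by (auto simp: assignments_def)
      then have "\<phi> i = Annihilation m b"
        using mode_exponent_eq_annihilation_iff[of "\<phi> i" N b m] assms loc by auto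
      then show "\<phi> \<in> {restrict (\<lambda>_. Annihilation m b) {i}}"
        using \<phi> by (auto simp: PiE_iff extensional_def restrict_def fun_eq_iff)
    qed (use loc in \<open>auto simp: assignments_def\<close>)
  qed
  ultimately show ?thesis
    by (simp add: X_field_def lambda_times_def fscale_def assignment_term_def normal_ordered_modes_def
        normal_product_eq_sum_assignments[OF _ local_mult_t_var] del: mode_exponent.simps mode_coeff.simps mode_op.simps)
qed

lemma hbar_half_pow_add: "hbar_half_pow (d + e) = hbar_half_pow d * hbar_half_pow e"
  by (simp add: hbar_half_pow_def fls_X_intpow_times_fls_X_intpow)

lemma hbar_half_pow_0 [simp]: "hbar_half_pow 0 = 1"
  by (simp add: hbar_half_pow_def)

lemma dilaton_coeff_eq: "dilaton_coeff N j = fls_const (- (eta N ^ j)) * hbar_half_pow (- 1)"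
proof -
  have "eta N powi (- int (j * N)) = eta N powi (int j - int ((N + 1) * j))"
    by (simp add: algebra_simps)
  also have "\<dots> = eta N ^ j / (eta N ^ (N + 1)) ^ j"
    by (subst power_int_diff) (simp_all only: eta_nonzero simp_thms power_int_of_nat power_mult)
  finally have "eta N powi (- int (j * N)) = eta N ^ j" by (simp only: eta_power_order power_one div_by_1)
  then show ?thesis by (simp add: dilaton_coeff_def)
qed

lemma prod_dilaton_coeff:
  "finite L \<Longrightarrow> (\<Prod>j\<in>L. dilaton_coeff N j) =
    fls_const (\<Prod>j\<in>L. - (eta N ^ j)) * hbar_half_pow (- int (card L))"
proof (induction L rule: finite_induct)
  case (insert j L)
  have "hbar_half_pow (- int (card (insert j L))) = hbar_half_pow (- 1) * hbar_half_pow (- int (card L))"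
    using insert by (simp flip: hbar_half_pow_add)
  with insert show ?case
    by (simp only: prod.insert simp_thms not_False_eq_True fls_const_mult_const[symmetric] dilaton_coeff_eq mult_ac)
qed simp

section \<open>Comparison of the two operators\<close>

text \<open>
  The common term of both operators that belongs to K, up to factors that do not depend on K.
\<close>

definition cluster_term :: "nat \<Rightarrow> nat \<Rightarrow> nat \<Rightarrow> formal_fun \<Rightarrow> monomial \<Rightarrow> nat set \<Rightarrow> complex fls" where
  "cluster_term N m a f M K =
     fls_const (\<Sum>i\<in>K. eta N powi (- int (i * a)) / (\<Prod>j\<in>K - {i}. eta N ^ i - eta N ^ j)) *
     hbar_half_pow (int (card K)) *
     X_field N t_var K
       (- 1 - of_nat m + (of_nat (card K) - of_nat (N + 2 - a)) / of_nat (N + 1)) f M"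

lemma fls_const_sum: "fls_const (\<Sum>x\<in>A. g x) = (\<Sum>x\<in>A. fls_const (g x))"
  by (induction A rule: infinite_finite_induct) (simp_all flip: fls_plus_const)

lemma W_op_q_var:
  assumes "a \<in> {1..N}"
  shows "W_op N (q_var N) m a f M =
    fls_const (of_real (of_nat (N + 1) powr (- 1 - of_nat m))) * hbar_half_pow (- int (N + 2 - a)) *
      (\<Sum>K | K \<subseteq> {1..N + 1} \<and> K \<noteq> {}. cluster_term N m a f M K)"
proof -
  let ?U = "{1..N + 1}"
  let ?r = "N + 2 - a"
  let ?p = "- 1 - of_nat m :: rat"
  let ?e = "\<lambda>L. fls_const (\<Prod>l\<in>L. - (eta N ^ l))"
  let ?X = "\<lambda>K. X_field N t_var K (?p + (of_nat (card K) - of_nat ?r) / of_nat (N + 1)) f M"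
  have N: "N \<ge> 1" using assms by simp
  have "(\<Sum>J | J \<subseteq> ?U \<and> card J = ?r. X_field N (q_var N) J ?p f M) =
      (\<Sum>J | J \<subseteq> ?U \<and> card J = ?r. \<Sum>K\<in>Pow J. ?e (J - K) * hbar_half_pow (int (card K) - int ?r) * ?X K)"
  proof (intro sum.cong refl)
    fix J assume "J \<in> {J. J \<subseteq> ?U \<and> card J = ?r}"
    then have J: "finite J" "card J = ?r" using finite_subset by auto
    have "(\<Prod>j\<in>J - K. dilaton_coeff N j) *
        X_field N t_var K (?p - of_nat (card (J - K)) / of_nat (N + 1)) f M =
      ?e (J - K) * hbar_half_pow (int (card K) - int ?r) * ?X K" if "K \<in> Pow J" for K
    proof -
      have K: "card K \<le> ?r" "card (J - K) = ?r - card K"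
        unfolding J(2)[symmetric] using that J(1) by (auto simp: card_Diff_subset finite_subset intro: card_mono)
      have "- int (card (J - K)) = int (card K) - int ?r" using K by linarith
      moreover have "?p - of_nat (card (J - K)) / of_nat (N + 1) =
          ?p + (of_nat (card K) - of_nat ?r) / of_nat (N + 1)"
        unfolding K(2) of_nat_diff[OF K(1)] by (simp add: diff_divide_distrib)
      ultimately show ?thesis using J by (simp only: prod_dilaton_coeff finite_Diff)
    qed
    then show "X_field N (q_var N) J ?p f M =
        (\<Sum>K\<in>Pow J. ?e (J - K) * hbar_half_pow (int (card K) - int ?r) * ?X K)"
      using X_field_q_var[OF J(1) N] by simp
  qed
  also have "\<dots> = (\<Sum>(J, K)\<in>(SIGMA J:{J. J \<subseteq> ?U \<and> card J = ?r}. Pow J).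
      ?e (J - K) * hbar_half_pow (int (card K) - int ?r) * ?X K)"
    by (intro sum.Sigma) (auto intro: finite_subset)
  also have "\<dots> = (\<Sum>(K, L)\<in>(SIGMA K:Pow ?U. {L. L \<subseteq> ?U - K \<and> card L + card K = ?r}).
      ?e L * hbar_half_pow (int (card K) - int ?r) * ?X K)"
  proof (rule sum.reindex_bij_witness[where j = "\<lambda>(J, K). (K, J - K)" and i = "\<lambda>(K, L). (K \<union> L, K)"], goal_cases)
    case (2 x)
    obtain J K where x: "x = (J, K)" by fastforce
    with 2 have J: "J \<subseteq> ?U" "card J = ?r" "K \<subseteq> J" by auto
    then have "finite J" using finite_subset by blast
    then have "card (J - K) + card K = ?r"
      using J card_mono[of J K] by (simp add: card_Diff_subset finite_subset)
    with J show ?case unfolding x by auto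
  next
    case (4 x)
    obtain K L where x: "x = (K, L)" by fastforce
    with 4 have KL: "K \<subseteq> ?U" "L \<subseteq> ?U - K" "card L + card K = ?r" by auto
    then have "finite K" "finite L" by (auto intro: finite_subset)
    then have "card (K \<union> L) = ?r" using KL by (subst card_Un_disjoint) auto
    with KL show ?case unfolding x by auto
  qed auto
  also have "\<dots> = (\<Sum>K\<in>Pow ?U. \<Sum>L | L \<subseteq> ?U - K \<and> card L + card K = ?r.
      ?e L * hbar_half_pow (int (card K) - int ?r) * ?X K)"
    by (intro sum.Sigma[symmetric]) auto
  also have "\<dots> = (\<Sum>K | K \<subseteq> ?U \<and> K \<noteq> {}. \<Sum>L | L \<subseteq> ?U - K \<and> card L + card K = ?r.
      ?e L * hbar_half_pow (int (card K) - int ?r) * ?X K)"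
  proof (rule sum.mono_neutral_right)
    have "of_nat ?r / of_nat (N + 1) \<ge> (0 :: rat)" "of_nat m \<ge> (0 :: rat)" by simp_all
    then have "?p + (of_nat (card {}) - of_nat ?r) / of_nat (N + 1) \<noteq> 0"
      unfolding card.empty of_nat_0 diff_0 minus_divide_left[symmetric] by linarith
    then have "?X {} = 0" by (rule X_field_empty)
    then show "\<forall>K\<in>Pow ?U - {K. K \<subseteq> ?U \<and> K \<noteq> {}}. (\<Sum>L | L \<subseteq> ?U - K \<and> card L + card K = ?r.
        ?e L * hbar_half_pow (int (card K) - int ?r) * ?X K) = 0"
      by auto
  qed auto
  also have "\<dots> = (\<Sum>K | K \<subseteq> ?U \<and> K \<noteq> {}. hbar_half_pow (- int ?r) * cluster_term N m a f M K)"
  proof (intro sum.cong refl)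
    fix K assume "K \<in> {K. K \<subseteq> ?U \<and> K \<noteq> {}}"
    then have K: "K \<subseteq> ?U" "K \<noteq> {}" by auto
    have "(\<Sum>L | L \<subseteq> ?U - K \<and> card L + card K = ?r. ?e L * hbar_half_pow (int (card K) - int ?r) * ?X K)
        = fls_const (\<Sum>L | L \<subseteq> ?U - K \<and> card L + card K = ?r. \<Prod>l\<in>L. - (eta N ^ l)) *
           hbar_half_pow (int (card K) - int ?r) * ?X K"
      by (simp only: sum_distrib_right[symmetric] fls_const_sum)
    also have "\<dots> = hbar_half_pow (- int ?r) * cluster_term N m a f M K"
      unfolding sum_over_eta_differences[OF K assms, symmetric] cluster_term_def
        diff_conv_add_uminus[of "int (card K)"] hbar_half_pow_add by (simp only: mult_ac)
    finally show "(\<Sum>L | L \<subseteq> ?U - K \<and> card L + card K = ?r.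
        ?e L * hbar_half_pow (int (card K) - int ?r) * ?X K) =
      hbar_half_pow (- int ?r) * cluster_term N m a f M K" .
  qed
  finally have sum_X: "(\<Sum>J | J \<subseteq> ?U \<and> card J = ?r. X_field N (q_var N) J ?p f M) =
    hbar_half_pow (- int ?r) * (\<Sum>K | K \<subseteq> ?U \<and> K \<noteq> {}. cluster_term N m a f M K)"
    by (simp only: sum_distrib_left)
  have real_p: "of_rat ?p = (- 1 - of_nat m :: real)"
    by (simp add: of_rat_diff of_rat_minus)
  have "W_op N (q_var N) m a f M = fls_const (of_real (of_nat (N + 1) powr (of_rat ?p))) *
      (\<Sum>J | J \<subseteq> ?U \<and> card J = ?r. X_field N (q_var N) J ?p f M)"
    unfolding W_op_def Res0_def lambda_times_def twisted_field_elem_sym_def twisted_field_def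
      rescale_def fscale_def sum_distrib_left ..
  then show ?thesis unfolding sum_X real_p by (simp only: mult.assoc)
qed

lemma cluster_term_singleton:
  assumes "a \<in> {1..N}"
  shows "cluster_term N m a f M {i} =
    hbar_half_pow 2 * (of_nat ((m + 1) * (N + 1)) - of_nat a) * x_diff N m a f M"
proof -
  define b where "b = N + 1 - a"
  have b: "b \<in> {1..N}" "N + 1 - b = a" "a + b = N + 1" using assms by (auto simp: b_def)
  have "(of_nat (card {i}) - of_nat (N + 2 - a)) / of_nat (N + 1) = (- (of_nat b / of_nat (N + 1)) :: rat)"
    using assms by (simp add: b_def of_nat_diff field_simps)
  then have exponent: "- 1 - of_nat m + (of_nat (card {i}) - of_nat (N + 2 - a)) / of_nat (N + 1) =
      mode_exponent N (Annihilation m b)" by simp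
  have "eta N powi (- int (i * a)) * eta N powi (- int (i * b)) = eta N powi (- int ((N + 1) * i))"
    unfolding b(3)[symmetric] by (subst power_int_add[symmetric]) (auto simp: algebra_simps)
  also have "\<dots> = 1"
    by (simp only: power_int_minus power_int_of_nat power_mult eta_power_order power_one inverse_1)
  finally have phases: "eta N powi (- int (i * a)) * eta N powi (- int (i * b)) = 1" .
  have "b + m * (N + 1) + a = (m + 1) * (N + 1)" using b(3) by simp
  then have "(of_nat (b + m * (N + 1)) :: complex fls) + of_nat a = of_nat ((m + 1) * (N + 1))"
    by (simp only: of_nat_add[symmetric])
  then have weight: "(of_nat (b + m * (N + 1)) :: complex fls) = of_nat ((m + 1) * (N + 1)) - of_nat a"
    by (simp only: eq_diff_eq)
  have "fls_const (eta N powi (- int (i * a))) * hbar_half_pow 1 * mode_coeff N i (Annihilation m b) =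
      hbar_half_pow 2 * of_nat (b + m * (N + 1)) *
      fls_const (eta N powi (- int (i * a)) * eta N powi (- int (i * b)))"
    unfolding mode_coeff.simps fls_of_nat fls_const_mult_const[symmetric]
    using hbar_half_pow_add[of 1 1] by (simp only: one_add_one mult_ac)
  also have "\<dots> = hbar_half_pow 2 * (of_nat ((m + 1) * (N + 1)) - of_nat a)"
    unfolding phases weight by simp
  finally have coeff: "fls_const (eta N powi (- int (i * a))) * hbar_half_pow 1 *
      mode_coeff N i (Annihilation m b) = hbar_half_pow 2 * (of_nat ((m + 1) * (N + 1)) - of_nat a)" .
  show ?thesis
    unfolding cluster_term_def exponent X_field_singleton_annihilation[OF b(1)] coeff[symmetric]
    by (simp add: b(2)[simplified] mult.assoc del: mode_coeff.simps)
qed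

lemma recursion_op_t_var:
  assumes "a \<in> {1..N}"
  shows "recursion_op N t_var m a f M = fls_const (1 / of_nat (N + 1)) * hbar_half_pow (- 2) *
    (\<Sum>K | K \<subseteq> {1..N + 1} \<and> K \<noteq> {}. cluster_term N m a f M K)"
proof -
  let ?U = "{1..N + 1}"
  let ?c = "fls_const (1 / of_nat (N + 1)) * hbar_half_pow (- 2) :: complex fls"
  let ?q = "\<lambda>K i. eta N powi (- int (i * a)) / (\<Prod>j\<in>K - {i}. eta N ^ i - eta N ^ j)"
  let ?X = "\<lambda>K. X_field N t_var K (- 1 - of_nat m + (of_nat (card K) - of_nat (N + 2 - a)) / of_nat (N + 1)) f M"
  let ?H = "\<lambda>i J. fls_const (1 / of_nat (N + 1) * (eta N powi (- int (i * a)) / (\<Prod>j\<in>J. eta N ^ i - eta N ^ j)))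
     * hbar_half_pow (int (card J) - 1) *
     Res0 (lambda_times (of_nat m + 1 - of_nat (a + card J) / of_nat (N + 1)) (X_field N t_var (insert i J))) f M"
  have singles: "?c * (\<Sum>K | K \<subseteq> ?U \<and> card K = 1. cluster_term N m a f M K) =
      (of_nat ((m + 1) * (N + 1)) - of_nat a) * x_diff N m a f M"
  proof -
    have "{K. K \<subseteq> ?U \<and> card K = 1} = (\<lambda>i. {i}) ` ?U"
      by (auto simp: card_1_singleton_iff)
    then have "(\<Sum>K | K \<subseteq> ?U \<and> card K = 1. cluster_term N m a f M K) =
        (\<Sum>i\<in>?U. hbar_half_pow 2 * ((of_nat ((m + 1) * (N + 1)) - of_nat a) * x_diff N m a f M))"
      by (simp add: sum.reindex cluster_term_singleton[OF assms] mult.assoc del: sum.cl_ivl_Suc)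
    also have "\<dots> = fls_const (of_nat (N + 1)) * (hbar_half_pow 2 * ((of_nat ((m + 1) * (N + 1)) - of_nat a) * x_diff N m a f M))"
      unfolding sum_constant fls_of_nat[symmetric] by simp
    also have "?c * \<dots> = (fls_const (1 / of_nat (N + 1)) * fls_const (of_nat (N + 1))) *
        (hbar_half_pow (- 2) * hbar_half_pow 2) * ((of_nat ((m + 1) * (N + 1)) - of_nat a) * x_diff N m a f M)"
      by (simp only: mult_ac)
    also have "hbar_half_pow (- 2) * hbar_half_pow 2 = 1"
      by (simp flip: hbar_half_pow_add)
    also have "fls_const (1 / of_nat (N + 1)) * fls_const (of_nat (N + 1)) = (1 :: complex fls)"
      by (simp del: of_nat_Suc of_nat_add)
    finally show ?thesis by (simp only: mult_1)
  qed
  have "(\<Sum>i=1..N+1. \<Sum>J | J \<subseteq> ?U - {i} \<and> J \<noteq> {}. ?H i J) =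
      (\<Sum>(i, J)\<in>(SIGMA i:?U. {J. J \<subseteq> ?U - {i} \<and> J \<noteq> {}}). ?H i J)"
    by (intro sum.Sigma) auto
  also have "\<dots> = (\<Sum>(K, i)\<in>(SIGMA K:{K. K \<subseteq> ?U \<and> card K \<ge> 2}. K). ?H i (K - {i}))"
  proof (rule sum.reindex_bij_witness[where j = "\<lambda>(i, J). (insert i J, i)" and i = "\<lambda>(K, i). (i, K - {i})"], goal_cases)
    case (2 x)
    obtain i J where x: "x = (i, J)" by fastforce
    with 2 have J: "i \<in> ?U" "J \<subseteq> ?U - {i}" "J \<noteq> {}" by auto
    then have fin: "finite J" "i \<notin> J" using finite_subset by auto
    with J have "card (insert i J) \<ge> 2" by (simp add: Suc_le_eq card_gt_0_iff)
    with J show ?case unfolding x by auto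
  next
    case (4 x)
    obtain K i where x: "x = (K, i)" by fastforce
    with 4 have K: "K \<subseteq> ?U" "card K \<ge> 2" "i \<in> K" by auto
    have "K \<noteq> {i}" using K(2) by auto
    with K show ?case unfolding x by auto
  next
    case (5 x)
    obtain i J where x: "x = (i, J)" by fastforce
    with 5 have "insert i J - {i} = J" by auto
    then show ?case unfolding x by (simp only: prod.case)
  qed auto
  also have "\<dots> = (\<Sum>K | K \<subseteq> ?U \<and> card K \<ge> 2. \<Sum>i\<in>K. ?H i (K - {i}))"
    by (intro sum.Sigma[symmetric]) (auto intro: finite_subset)
  also have "\<dots> = (\<Sum>K | K \<subseteq> ?U \<and> card K \<ge> 2. ?c * cluster_term N m a f M K)"
  proof (intro sum.cong refl)
    fix K assume "K \<in> {K. K \<subseteq> ?U \<and> card K \<ge> 2}"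
    then have K: "finite K" "card K \<ge> 2" using finite_subset by auto
    have "?H i (K - {i}) = ?c * (fls_const (?q K i) * hbar_half_pow (int (card K)) * ?X K)" if "i \<in> K" for i
    proof -
      have card: "card (K - {i}) = card K - 1" "insert i (K - {i}) = K" using K that by auto
      have "int (card K - 1) - 1 = - 2 + int (card K)" using K by linarith
      then have hbar: "hbar_half_pow (int (card K - 1) - 1) = hbar_half_pow (- 2) * hbar_half_pow (int (card K))"
        by (simp only: hbar_half_pow_add)
      have "- 1 - (of_nat m + 1 - of_nat (a + (card K - 1)) / of_nat (N + 1)) =
          (- 1 - of_nat m + (of_nat (card K) - of_nat (N + 2 - a)) / of_nat (N + 1) :: rat)"
        using K(2) assms by (simp add: of_nat_diff field_simps)
      then show ?thesis
        unfolding Res0_def lambda_times_def card hbar fls_const_mult_const[symmetric] by (simp only: mult_ac)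
    qed
    then have "(\<Sum>i\<in>K. ?H i (K - {i})) = (\<Sum>i\<in>K. ?c * (fls_const (?q K i) * hbar_half_pow (int (card K)) * ?X K))"
      by (intro sum.cong refl)
    then show "(\<Sum>i\<in>K. ?H i (K - {i})) = ?c * cluster_term N m a f M K"
      unfolding cluster_term_def fls_const_sum sum_distrib_left sum_distrib_right .
  qed
  finally have multiples: "(\<Sum>i=1..N+1. \<Sum>J | J \<subseteq> ?U - {i} \<and> J \<noteq> {}. ?H i J) =
      ?c * (\<Sum>K | K \<subseteq> ?U \<and> card K \<ge> 2. cluster_term N m a f M K)"
    by (simp only: sum_distrib_left)
  have split: "{K. K \<subseteq> ?U \<and> K \<noteq> {}} = {K. K \<subseteq> ?U \<and> card K = 1} \<union> {K. K \<subseteq> ?U \<and> card K \<ge> 2}"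
  proof (intro equalityI subsetI)
    fix K assume K: "K \<in> {K. K \<subseteq> ?U \<and> K \<noteq> {}}"
    then have "finite K" using finite_subset by auto
    with K have "card K > 0" by (auto simp: card_gt_0_iff)
    with K show "K \<in> {K. K \<subseteq> ?U \<and> card K = 1} \<union> {K. K \<subseteq> ?U \<and> card K \<ge> 2}" by auto
  qed auto
  have "(\<Sum>K | K \<subseteq> ?U \<and> K \<noteq> {}. cluster_term N m a f M K) =
      (\<Sum>K | K \<subseteq> ?U \<and> card K = 1. cluster_term N m a f M K) +
      (\<Sum>K | K \<subseteq> ?U \<and> card K \<ge> 2. cluster_term N m a f M K)"
    unfolding split by (intro sum.union_disjoint) auto
  then show ?thesis
    unfolding recursion_op_def fscale_def multiples singles[symmetric] by (simp only: distrib_left)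
qed

lemma recursion_op_eq_W_op:
  assumes "a \<in> {1..N}"
  shows "recursion_op N t_var m a f =
    fscale (fls_const (of_nat (N + 1) ^ m) * hbar_half_pow (int N - int a)) (W_op N (q_var N) m a f)"
proof
  fix M
  let ?s = "\<Sum>K | K \<subseteq> {1..N + 1} \<and> K \<noteq> {}. cluster_term N m a f M K"
  have "of_nat (N + 1) powr (- 1 - of_nat m :: real) = 1 / of_nat (N + 1) ^ (m + 1)"
    by (simp add: powr_diff powr_minus powr_realpow divide_simps del: of_nat_Suc of_nat_add)
  then have scalars: "of_nat (N + 1) ^ m * of_real (of_nat (N + 1) powr (- 1 - of_nat m :: real)) =
      (1 / of_nat (N + 1) :: complex)"
    by (simp del: of_nat_Suc of_nat_add)
  have hbar: "hbar_half_pow (int N - int a) * hbar_half_pow (- int (N + 2 - a)) = hbar_half_pow (- 2)"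
    using assms by (subst hbar_half_pow_add[symmetric]) (simp add: of_nat_diff)
  have "fscale (fls_const (of_nat (N + 1) ^ m) * hbar_half_pow (int N - int a)) (W_op N (q_var N) m a f) M =
    fls_const (of_nat (N + 1) ^ m * of_real (of_nat (N + 1) powr (- 1 - of_nat m :: real))) *
    (hbar_half_pow (int N - int a) * hbar_half_pow (- int (N + 2 - a))) * ?s"
    unfolding fscale_def W_op_q_var[OF assms] fls_const_mult_const[symmetric] by (simp only: mult_ac)
  also have "\<dots> = recursion_op N t_var m a f M"
    unfolding scalars hbar recursion_op_t_var[OF assms] ..
  finally show "recursion_op N t_var m a f M =
    fscale (fls_const (of_nat (N + 1) ^ m) * hbar_half_pow (int N - int a)) (W_op N (q_var N) m a f) M" ..
qed

theorem theorem1p3: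
  fixes N :: nat
    and R :: "'c::ab_group_add moduli_cohomology"
    and \<sigma> :: "(nat \<Rightarrow> complex) \<Rightarrow> (nat \<Rightarrow> complex)"
    and \<Lambda> :: "nat \<Rightarrow> nat list \<Rightarrow> 'c"
  assumes "N \<ge> 1"
    and "stable_curve_cohomology R"
    and "flat_coordinates N \<sigma>"
    and "A_singularity_cohft R N \<sigma> \<Lambda>"
  shows "(\<forall>a\<in>{1..N}. \<forall>m. \<exists>(c::complex) (e::int). c \<noteq> 0 \<and>
            (\<forall>f. recursion_op N t_var m a f = fscale (fls_const c * hbar_half_pow e) (W_op N (q_var N) m a f)))
       \<and> ((\<forall>a\<in>{1..N}. \<forall>m. recursion_op N t_var m a (total_descendant_potential R N \<Lambda>) = (\<lambda>_. 0)) \<longleftrightarrow>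
          (\<forall>a\<in>{1..N}. \<forall>m. W_op N (q_var N) m a (total_descendant_potential R N \<Lambda>) = (\<lambda>_. 0)))"
proof (intro conjI ballI allI)
  fix a m assume a: "a \<in> {1..N}"
  have "of_nat (N + 1) ^ m \<noteq> (0 :: complex)" by (simp del: of_nat_Suc of_nat_add)
  with recursion_op_eq_W_op[OF a] show "\<exists>(c::complex) (e::int). c \<noteq> 0 \<and>
      (\<forall>f. recursion_op N t_var m a f = fscale (fls_const c * hbar_half_pow e) (W_op N (q_var N) m a f))"
    by blast
next
  have "fscale (fls_const (of_nat (N + 1) ^ m) * hbar_half_pow e) g = (\<lambda>_. 0) \<longleftrightarrow> g = (\<lambda>_. 0)"
    for m e and g :: formal_fun
    by (simp add: fscale_def fun_eq_iff hbar_half_pow_def del: of_nat_Suc of_nat_add)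
  then show "(\<forall>a\<in>{1..N}. \<forall>m. recursion_op N t_var m a (total_descendant_potential R N \<Lambda>) = (\<lambda>_. 0)) \<longleftrightarrow>
      (\<forall>a\<in>{1..N}. \<forall>m. W_op N (q_var N) m a (total_descendant_potential R N \<Lambda>) = (\<lambda>_. 0))"
    by (simp add: recursion_op_eq_W_op)
qed

end
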